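(* Let $k\ge -\tfrac12$, let $M=\begin{pmatrix} a & b\\ c& d\end{pmatrix}$ be a real matrix with $\det M=1$ and $b\neq 0$, let $m\in\mathbb{R}$, and let $\sigma\in S_0^m$. Then $f\mapsto P_{\sigma,M}(f)$ defines a continuous linear mapping from $\mathcal{S}(\mathbb{R})$ into itself.
   Context: Notation (the symbol is written $\sigma$ to avoid a clash with the matrix entry $a$). $d\mu_k(x)=\frac{|x|^{2k+1}}{2^{k+1}\Gamma(k+1)}dx$ on $\mathbb{R}$. Powers $(ib)^{k+1}$ use the principal branch. $\mathcal{S}(\mathbb{R})$ is the Schwartz space with its usual topology. Dunkl kernel: for real $\lambda,x$, $E_k(i\lambda,x)=j_k(\lambda x)+\frac{i\lambda x}{2(k+1)}j_{k+1}(\lambda x)$, where $j_\nu(z)=\Gamma(\nu+1)\sum_{n\ge0}\frac{(-1)^n(z/2)^{2n}}{n!\,\Gamma(n+\nu+1)}$. Linear canonical Dunkl kernel: $E_k^M(\lambda,x)=e^{\frac{i}{2}\left(\frac{d}{b}\lambda^2+\frac{a}{b}x^2\right)}E_k(-i\lambda/b,x)$. Since $M^{-1}=\begin{pmatrix} d&-b\\-c&a\end{pmatrix}$, one has $E_k^{M^{-1}}(x,\lambda)=e^{-\frac{i}{2}\left(\frac{a}{b}x^2+\frac{d}{b}\lambda^2\right)}E_k(ix/b,\lambda)$. Linear canonical Dunkl transform: $\mathcal{D}_k^M(f)(\lambda)=\frac{1}{(ib)^{k+1}}\int_{\mathbb{R}}f(x)E_k^M(\lambda,x)\,d\mu_k(x)$.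 Symbol class $S_0^m$ ($m\in\mathbb{R}$): all $\sigma\in C^\infty(\mathbb{R}\times\mathbb{R};\mathbb{C})$ such that for all integers $l,n\ge0$ there is a constant $C$ with $|\partial_x^l\partial_\lambda^n\sigma(x,\lambda)|\le C(1+|\lambda|^2)^{(m-n)/2}$ for all $x,\lambda\in\mathbb{R}$. Pseudo-differential operator: $P_{\sigma,M}(f)(x)=\int_{\mathbb{R}}\sigma(x,\lambda)\,\mathcal{D}_k^M(f)(\lambda)\,E_k^{M^{-1}}(x,\lambda)\,d\mu_k(\lambda)$ for $f\in\mathcal{S}(\mathbb{R})$. *)

theory Defs
  imports "HOL-Analysis.Analysis"
begin

definition iter_deriv :: "nat \<Rightarrow> (real \<Rightarrow> complex) \<Rightarrow> real \<Rightarrow> complex" where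
  "iter_deriv n f = ((\<lambda>g x. vector_derivative g (at x)) ^^ n) f"

definition schwartz_space :: "(real \<Rightarrow> complex) set" where
  "schwartz_space =
     {f. (\<forall>n x. iter_deriv n f differentiable (at x)) \<and>
         (\<forall>l n. bounded (range (\<lambda>x. of_real (x ^ l) * iter_deriv n f x)))}"

definition schwartz_seminorm :: "nat \<Rightarrow> nat \<Rightarrow> (real \<Rightarrow> complex) \<Rightarrow> real" where
  "schwartz_seminorm l n f = (SUP x. cmod (of_real (x ^ l) * iter_deriv n f x))"

(* The locally convex topology of the family of seminorms above: the open seminorm balls around
   all points of the space form a subbase. *)
definition schwartz_topology :: "(real \<Rightarrow> complex) topology" where
  "schwartz_topology = topology_generated_by
     {{g \<in> schwartz_space. schwartz_seminorm l n (\<lambda>x. g x - f x) < e} | f l n e.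
        f \<in> schwartz_space \<and> 0 < e}"

lemma topspace_schwartz_topology: "topspace schwartz_topology = schwartz_space"
proof -
  have "iter_deriv n (\<lambda>x. 0) = (\<lambda>x. 0)" for n
    by (induction n) (auto simp: iter_deriv_def)
  hence "schwartz_seminorm l n (\<lambda>x. f x - f x) < 1" for l n f
    by (simp add: schwartz_seminorm_def)
  hence "f \<in> topspace schwartz_topology" if "f \<in> schwartz_space" for f
    unfolding schwartz_topology_def topology_generated_by_topspace using that
    by (intro UnionI[of "{g \<in> schwartz_space. schwartz_seminorm 0 0 (\<lambda>x. g x - f x) < 1}"]
        CollectI exI[of _ f] exI[of _ "0::nat"] exI[of _ "1::real"]) auto
  moreover have "topspace schwartz_topology \<subseteq> schwartz_space"
    unfolding schwartz_topology_def topology_generated_by_topspace by (rule Union_least) auto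
  ultimately show ?thesis by (intro equalityI subsetI) auto
qed

(* For k = -1/2 the convention 0 powr 0 = 0 (instead of 1) only concerns the null set {0}. *)
definition dunkl_measure :: "real \<Rightarrow> real measure" where
  "dunkl_measure k = density lborel
     (\<lambda>x. ennreal (\<bar>x\<bar> powr (2 * k + 1) / (2 powr (k + 1) * Gamma (k + 1))))"

definition normalized_bessel :: "real \<Rightarrow> real \<Rightarrow> real" where
  "normalized_bessel \<nu> z =
     Gamma (\<nu> + 1) * (\<Sum>n. (-1) ^ n * (z / 2) ^ (2 * n) / (fact n * Gamma (real n + \<nu> + 1)))"

(* dunkl_kernel k lam x is E_k(i lam, x): the imaginary unit is built in. *)
definition dunkl_kernel :: "real \<Rightarrow> real \<Rightarrow> real \<Rightarrow> complex" where
  "dunkl_kernel k lam x =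
     of_real (normalized_bessel k (lam * x)) +
     \<i> * of_real (lam * x) / of_real (2 * (k + 1)) * of_real (normalized_bessel (k + 1) (lam * x))"

(* With M = (a b; c d): a = M $ 1 $ 1, b = M $ 1 $ 2, d = M $ 2 $ 2. *)
definition lc_dunkl_kernel :: "real \<Rightarrow> real^2^2 \<Rightarrow> real \<Rightarrow> real \<Rightarrow> complex" where
  "lc_dunkl_kernel k M lam x =
     exp (\<i> / 2 * of_real (M $ 2 $ 2 / M $ 1 $ 2 * lam\<^sup>2 + M $ 1 $ 1 / M $ 1 $ 2 * x\<^sup>2)) *
     dunkl_kernel k (- lam / M $ 1 $ 2) x"

lemma lc_dunkl_kernel_matrix_inv:
  fixes M :: "real^2^2"
  assumes "det M = 1"
  shows "lc_dunkl_kernel k (matrix_inv M) x lam =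
     exp (- \<i> / 2 * of_real (M $ 1 $ 1 / M $ 1 $ 2 * x\<^sup>2 + M $ 2 $ 2 / M $ 1 $ 2 * lam\<^sup>2)) *
     dunkl_kernel k (x / M $ 1 $ 2) lam"
proof -
  define N :: "real^2^2" where
    "N = vector [vector [M $ 2 $ 2, - M $ 1 $ 2], vector [- M $ 2 $ 1, M $ 1 $ 1]]"
  have d: "M $ 1 $ 1 * M $ 2 $ 2 - M $ 1 $ 2 * M $ 2 $ 1 = 1"
    using assms by (simp add: det_2)
  have N: "M ** N = mat 1" "N ** M = mat 1"
    using d by (simp_all add: N_def vec_eq_iff forall_2 matrix_matrix_mult_def mat_def sum_2
        algebra_simps)
  hence "\<exists>N. M ** N = mat 1 \<and> N ** M = mat 1"
    by blast
  hence inv: "matrix_inv M ** M = mat 1"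
    unfolding matrix_inv_def by (rule someI_ex[THEN conjunct2])
  have "matrix_inv M = matrix_inv M ** (M ** N)"
    by (simp only: N matrix_mul_rid)
  also have "\<dots> = N"
    by (simp only: matrix_mul_assoc inv matrix_mul_lid)
  finally have "matrix_inv M = N" .
  hence "matrix_inv M $ 1 $ 1 = M $ 2 $ 2" "matrix_inv M $ 1 $ 2 = - M $ 1 $ 2"
    "matrix_inv M $ 2 $ 2 = M $ 1 $ 1"
    by (simp_all add: N_def)
  moreover have "\<i> / 2 * complex_of_real (p / (- q) * u + r / (- q) * v) =
      - \<i> / 2 * complex_of_real (p / q * u + r / q * v)" for p q r u v :: real
    by (simp add: diff_divide_distrib add_divide_distrib ring_distribs)
  moreover have "- x / (- M $ 1 $ 2) = x / M $ 1 $ 2"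
    by simp
  ultimately show ?thesis
    by (simp only: lc_dunkl_kernel_def)
qed

definition lc_dunkl_transform ::
    "real \<Rightarrow> real^2^2 \<Rightarrow> (real \<Rightarrow> complex) \<Rightarrow> real \<Rightarrow> complex" where
  "lc_dunkl_transform k M f lam =
     1 / ((\<i> * of_real (M $ 1 $ 2)) powr of_real (k + 1)) *
     (LINT x | dunkl_measure k. f x * lc_dunkl_kernel k M lam x)"

definition pdiff1 :: "(real \<Rightarrow> real \<Rightarrow> complex) \<Rightarrow> real \<Rightarrow> real \<Rightarrow> complex" where
  "pdiff1 \<sigma> x lam = vector_derivative (\<lambda>s. \<sigma> s lam) (at x)"

definition pdiff2 :: "(real \<Rightarrow> real \<Rightarrow> complex) \<Rightarrow> real \<Rightarrow> real \<Rightarrow> complex" where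
  "pdiff2 \<sigma> x lam = vector_derivative (\<lambda>t. \<sigma> x t) (at lam)"

(* C^N on the plane: continuous, with both partial derivatives existing everywhere and
   of class C^(N-1). *)
fun C_class :: "nat \<Rightarrow> (real \<Rightarrow> real \<Rightarrow> complex) \<Rightarrow> bool" where
  "C_class 0 \<sigma> \<longleftrightarrow> continuous_on UNIV (\<lambda>(x, lam). \<sigma> x lam)"
| "C_class (Suc N) \<sigma> \<longleftrightarrow> continuous_on UNIV (\<lambda>(x, lam). \<sigma> x lam) \<and>
     (\<forall>x lam. (\<lambda>s. \<sigma> s lam) differentiable (at x) \<and> (\<lambda>t. \<sigma> x t) differentiable (at lam)) \<and>
     C_class N (pdiff1 \<sigma>) \<and> C_class N (pdiff2 \<sigma>)"

definition symbol_class :: "real \<Rightarrow> (real \<Rightarrow> real \<Rightarrow> complex) set" where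
  "symbol_class m =
     {\<sigma>. (\<forall>N. C_class N \<sigma>) \<and>
         (\<forall>l n. \<exists>C. \<forall>x lam.
            cmod ((pdiff1 ^^ l) ((pdiff2 ^^ n) \<sigma>) x lam) \<le> C * (1 + \<bar>lam\<bar>\<^sup>2) powr ((m - real n) / 2))}"

definition pseudo_diff_op ::
    "real \<Rightarrow> real^2^2 \<Rightarrow> (real \<Rightarrow> real \<Rightarrow> complex) \<Rightarrow> (real \<Rightarrow> complex) \<Rightarrow> real \<Rightarrow> complex" where
  "pseudo_diff_op k M \<sigma> f x =
     (LINT lam | dunkl_measure k.
        \<sigma> x lam * lc_dunkl_transform k M f lam * lc_dunkl_kernel k (matrix_inv M) x lam)"

end

(* The chirp factors in lambda are smooth multipliers with polynomially bounded derivatives, as is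
   the symbol, so the operator reduces to two Dunkl integrals
     x |-> int A(x, l) E_k(i c x l) |l|^(2k+1) dl
   of families A that are Schwartz in l uniformly in the parameter x. Splitting A into its even part
   and l times an even family turns such an integral into the Hankel transforms
     H_nu A (x) = int A(x, l) j_nu(c x l) |l|^(2 nu + 1) dl,  A even in l.
   Two identities control them: the x-derivative is H_nu (d_x A) - c^2 x / (2 nu + 2) H_(nu+1) A,
   and the symmetric Bessel operator L satisfies (c x)^2 H_nu A = - H_nu (L A). Since |j_nu| <= 1 and
   |j_nu'| <= 1 for nu >= -1/2, all derivatives of H_nu A decay rapidly, with bounds by finitely many
   seminorms of the input function. *)

theory Submission
  imports Defs "HOL-Probability.Sinc_Integral"
begin

subsection \<open>Normalized Bessel functions\<close>

text \<open>The symbol gives no decay in x, and x is also the point at which the operator is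
  evaluated, so the decay of the output must come from the oscillation of the kernel alone. Hence
  families carry x as a passive parameter: L acts only in l, and a factor x^2 is traded for
  l-derivatives of A without differentiating the symbol in x. The obstacle is the singular
  coefficient 1/l in L. It is harmless on even families, since their l-derivative is odd and can be
  divided by l within the same class. The input function f is an argument of every family, so that
  \<open>tame\<close> records smoothness, decay and the continuity estimate in f at once. The class
  is closed under the Dunkl integral, and this one fact serves twice: for the transform of a chirp
  times f, then for the symbol times a chirp times that transform. Each x-derivative raises the
  Bessel order by one, which is why the estimates are made for all orders \<nu> >= -1/2 and not for
  k alone.\<close>

definition bessel_coeff :: "real \<Rightarrow> nat \<Rightarrow> real" where
  "bessel_coeff \<nu> n = (-1) ^ n / (4 ^ n * fact n * pochhammer (\<nu> + 1) n)"

text \<open>In the variable y = z^2 the even function j_\<nu> becomes an ordinary everywhere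
  convergent power series, so termwise differentiation applies directly.\<close>

definition bessel_series :: "real \<Rightarrow> real \<Rightarrow> real" where
  "bessel_series \<nu> y = (\<Sum>n. bessel_coeff \<nu> n * y ^ n)"

lemma bessel_coeff_Suc:
  "bessel_coeff \<nu> (Suc n) =
     - bessel_coeff \<nu> n / (4 * (real n + 1) * (real n + \<nu> + 1))"
  by (simp add: bessel_coeff_def pochhammer_Suc algebra_simps)

lemma summable_bessel_series:
  assumes "\<nu> \<ge> - 1 / 2"
  shows "summable (\<lambda>n. bessel_coeff \<nu> n * y ^ n)"
\<comment> \<open>From this index on |y| <= n, and \<nu> + 1 >= 1/2 keeps the last factor of the
  denominator at least 1/2; together they make the ratio of consecutive terms at most 1/2.\<close>
proof (rule summable_ratio_test[of "1 / 2" "nat \<lceil>\<bar>y\<bar>\<rceil>"])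
  fix n assume "nat \<lceil>\<bar>y\<bar>\<rceil> \<le> n"
  hence y: "\<bar>y\<bar> \<le> real n" by linarith
  have "\<bar>y\<bar> \<le> 2 * (real n + 1) * (real n + \<nu> + 1)"
  proof -
    have "\<bar>y\<bar> \<le> 2 * (real n + 1) * (1 / 2)" using y by simp
    also have "\<dots> \<le> 2 * (real n + 1) * (real n + \<nu> + 1)"
      by (intro mult_left_mono) (use assms in auto)
    finally show ?thesis .
  qed
  moreover have "0 < (real n + 1) * (real n + \<nu> + 1)"
    using assms by (intro mult_pos_pos) auto
  ultimately have q: "\<bar>y\<bar> / (4 * (real n + 1) * (real n + \<nu> + 1)) \<le> 1 / 2"
    by (simp add: field_simps)
  have "norm (bessel_coeff \<nu> (Suc n) * y ^ Suc n) =
      \<bar>y\<bar> / (4 * (real n + 1) * (real n + \<nu> + 1)) * norm (bessel_coeff \<nu> n * y ^ n)"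
    using assms by (simp add: bessel_coeff_Suc abs_mult)
  also have "\<dots> \<le> 1 / 2 * norm (bessel_coeff \<nu> n * y ^ n)"
    by (intro mult_right_mono q) auto
  finally show "norm (bessel_coeff \<nu> (Suc n) * y ^ Suc n) \<le> 1 / 2 * norm (bessel_coeff \<nu> n * y ^ n)" .
qed auto

lemma normalized_bessel_eq_series:
  assumes "\<nu> \<ge> - 1 / 2"
  shows "normalized_bessel \<nu> z = bessel_series \<nu> (z\<^sup>2)"
proof -
  have nz: "Gamma (\<nu> + 1) \<noteq> 0"
    using Gamma_real_pos[of "\<nu> + 1"] assms by fastforce
  have G: "Gamma (real n + \<nu> + 1) = pochhammer (\<nu> + 1) n * Gamma (\<nu> + 1)" for n
  proof -
    have "\<nu> + 1 \<notin> \<int>\<^sub>\<le>\<^sub>0" using assms by (auto elim!: nonpos_Ints_cases)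
    hence "pochhammer (\<nu> + 1) n = Gamma (\<nu> + 1 + real n) / Gamma (\<nu> + 1)"
      by (rule pochhammer_Gamma)
    thus ?thesis using nz by (simp add: algebra_simps)
  qed
  have p: "((z / 2) ^ (2 * n)) = (z\<^sup>2) ^ n / 4 ^ n" for n
    by (simp add: power_mult power_divide)
  have eq: "(-1) ^ n * (z / 2) ^ (2 * n) / (fact n * Gamma (real n + \<nu> + 1)) =
      bessel_coeff \<nu> n * (z\<^sup>2) ^ n / Gamma (\<nu> + 1)" for n
    unfolding G p bessel_coeff_def by simp
  show ?thesis
    unfolding normalized_bessel_def eq bessel_series_def
    using nz summable_bessel_series[OF assms, of "z\<^sup>2"] by (simp add: suminf_divide)
qed

text \<open>Splitting the first factor off \<open>pochhammer (\<nu> + 1) (Suc n)\<close> leaves the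
  Pochhammer symbol of order \<nu> + 1; this is why differentiation raises the order.\<close>

lemma diffs_bessel_coeff:
  assumes "\<nu> \<ge> - 1 / 2"
  shows "diffs (bessel_coeff \<nu>) n = - bessel_coeff (\<nu> + 1) n / (4 * (\<nu> + 1))"
proof -
  have "m * (- s / (4 * p * (m * q) * (v * P))) = - (s / (p * q * P)) / (4 * v)"
    if "m \<noteq> 0" for m s p q v P :: real
    using that by simp
  from this[of "real (Suc n)"] show ?thesis
    unfolding diffs_def bessel_coeff_def pochhammer_rec by (simp add: mult.assoc)
qed

lemma bessel_series_deriv:
  assumes "\<nu> \<ge> - 1 / 2"
  shows "(bessel_series \<nu> has_real_derivative - bessel_series (\<nu> + 1) y / (4 * (\<nu> + 1))) (at y)"
proof -
  have "(bessel_series \<nu> has_real_derivative (\<Sum>n. diffs (bessel_coeff \<nu>) n * y ^ n)) (at y)"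
    unfolding bessel_series_def
    by (rule termdiffs_strong_converges_everywhere) (rule summable_bessel_series[OF assms])
  also have "(\<lambda>n. diffs (bessel_coeff \<nu>) n * y ^ n) =
      (\<lambda>n. bessel_coeff (\<nu> + 1) n * y ^ n * (- 1 / (4 * (\<nu> + 1))))"
    using diffs_bessel_coeff[OF assms] by (auto simp: fun_eq_iff)
  also have "(\<Sum>n. bessel_coeff (\<nu> + 1) n * y ^ n * (- 1 / (4 * (\<nu> + 1)))) =
      bessel_series (\<nu> + 1) y * (- 1 / (4 * (\<nu> + 1)))"
    unfolding bessel_series_def
    by (intro suminf_mult2[symmetric] summable_bessel_series) (use assms in auto)
  finally show ?thesis by simp
qed

text \<open>The classical relation J_\<nu> + J_(\<nu>+2) = (2 (\<nu> + 1) / z) J_(\<nu>+1) in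
  normalized form. The constant terms on the left cancel, so coefficient n + 1 there is compared
  with coefficient n on the right.\<close>

lemma bessel_series_recurrence:
  assumes "\<nu> \<ge> - 1 / 2"
  shows "bessel_series (\<nu> + 1) y - bessel_series \<nu> y =
     y * bessel_series (\<nu> + 2) y / (4 * (\<nu> + 1) * (\<nu> + 2))"
proof -
  have s: "summable (\<lambda>n. bessel_coeff (\<nu> + 1) n * y ^ n - bessel_coeff \<nu> n * y ^ n)"
    by (intro summable_diff summable_bessel_series) (use assms in auto)
  have eq: "bessel_coeff (\<nu> + 1) (Suc n) * y ^ Suc n - bessel_coeff \<nu> (Suc n) * y ^ Suc n =
      (bessel_coeff (\<nu> + 2) n * y ^ n) * (y / (4 * (\<nu> + 1) * (\<nu> + 2)))" for n
  proof -
    have P: "pochhammer (\<nu> + 3) n > 0" "real n + 1 > 0" "\<nu> + 1 > 0" "\<nu> + 2 > 0" "\<nu> + 2 + n > 0"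
      using assms by (auto intro!: pochhammer_pos)
    have a: "pochhammer (\<nu> + 2) (Suc n) = (\<nu> + 2) * pochhammer (\<nu> + 3) n"
      by (simp add: pochhammer_rec add.assoc)
    have b: "pochhammer (\<nu> + 2) (Suc n) = pochhammer (\<nu> + 2) n * (\<nu> + 2 + n)"
      by (simp add: pochhammer_Suc)
    have "pochhammer (\<nu> + 2) n = (\<nu> + 2) * pochhammer (\<nu> + 3) n / (\<nu> + 2 + n)"
      using a b P by (simp add: field_simps)
    hence "pochhammer (\<nu> + 1) (Suc n) = (\<nu> + 1) * ((\<nu> + 2) * pochhammer (\<nu> + 3) n / (\<nu> + 2 + n))"
      by (simp add: pochhammer_rec add.assoc)
    moreover
    \<comment> \<open>Opaque letters keep the simplifier from rearranging powers and factorials: m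
      is n + 1, n1 and n2 are \<nu> + 1 and \<nu> + 2, w is \<nu> + 2 + n. The content is w / n1 - 1
      = m / n1.\<close>
    have "- s / (4 * p * (m * F) * (n2 * Q)) * (y * Y)
        - - s / (4 * p * (m * F) * (n1 * (n2 * Q / w))) * (y * Y) =
        s / (p * F * Q) * Y * (y / (4 * n1 * n2))"
      if "m > 0" "n1 > 0" "n2 > 0" "p > 0" "F > 0" "Q > 0" "w = n1 + m" for s p m F n1 n2 Q w Y :: real
    proof -
      have "- s / (4 * p * (m * F) * (n2 * Q)) * (y * Y)
          - - s / (4 * p * (m * F) * (n1 * (n2 * Q / w))) * (y * Y) =
          s * y * Y / (4 * p * (m * F) * (n2 * Q)) * (w / n1 - 1)"
        using that(1-6) by (simp add: right_diff_distrib diff_divide_distrib mult_ac)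
      also have "w / n1 - 1 = m / n1" using that by (simp add: field_simps)
      finally show ?thesis using that by (simp add: mult_ac)
    qed
    moreover note this[of "real (Suc n)" "\<nu> + 1" "\<nu> + 2" "4 ^ n" "fact n" "pochhammer (\<nu> + 3) n"
        "\<nu> + 2 + n" "(-1) ^ n" "y ^ n"]
    ultimately show ?thesis
      using a P unfolding bessel_coeff_def by (simp add: add.assoc)
  qed
  have "bessel_series (\<nu> + 1) y - bessel_series \<nu> y =
      (\<Sum>n. bessel_coeff (\<nu> + 1) n * y ^ n - bessel_coeff \<nu> n * y ^ n)"
    unfolding bessel_series_def
    by (intro suminf_diff summable_bessel_series) (use assms in auto)
  also have "\<dots> = (\<Sum>n. (bessel_coeff (\<nu> + 2) n * y ^ n) * (y / (4 * (\<nu> + 1) * (\<nu> + 2))))"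
    using suminf_split_head[OF s] unfolding eq by (simp add: bessel_coeff_def)
  also have "\<dots> = bessel_series (\<nu> + 2) y * (y / (4 * (\<nu> + 1) * (\<nu> + 2)))"
    unfolding bessel_series_def
    by (intro suminf_mult2[symmetric] summable_bessel_series) (use assms in auto)
  finally show ?thesis by (simp add: mult.commute)
qed

lemma normalized_bessel_deriv:
  assumes "\<nu> \<ge> - 1 / 2"
  shows "(normalized_bessel \<nu> has_real_derivative
     - z * normalized_bessel (\<nu> + 1) z / (2 * (\<nu> + 1))) (at z)"
proof -
  have "normalized_bessel \<nu> = (\<lambda>z. bessel_series \<nu> (z\<^sup>2))"
    using normalized_bessel_eq_series[OF assms] by auto
  moreover have "((\<lambda>z. bessel_series \<nu> (z\<^sup>2)) has_real_derivative
      - bessel_series (\<nu> + 1) (z\<^sup>2) / (4 * (\<nu> + 1)) * (2 * z)) (at z)"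
    by (rule DERIV_chain2[OF bessel_series_deriv[OF assms]]) (auto intro!: derivative_eq_intros)
  moreover have "- bessel_series (\<nu> + 1) (z\<^sup>2) / (4 * (\<nu> + 1)) * (2 * z) =
      - z * normalized_bessel (\<nu> + 1) z / (2 * (\<nu> + 1))"
    using normalized_bessel_eq_series[of "\<nu> + 1" z] assms by (simp add: field_simps)
  ultimately show ?thesis by simp
qed

text \<open>The recurrence eliminates order \<nu> + 2 from the derivative of j_(\<nu>+1). Keeping
  the factor z on the left avoids a division at z = 0.\<close>

lemma normalized_bessel_deriv_Suc:
  assumes "\<nu> \<ge> - 1 / 2"
  shows "\<exists>d. (normalized_bessel (\<nu> + 1) has_real_derivative d) (at z) \<and>
     z * d = 2 * (\<nu> + 1) * (normalized_bessel \<nu> z - normalized_bessel (\<nu> + 1) z)"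
proof (intro exI conjI)
  show "(normalized_bessel (\<nu> + 1) has_real_derivative
      - z * normalized_bessel (\<nu> + 1 + 1) z / (2 * (\<nu> + 1 + 1))) (at z)"
    by (rule normalized_bessel_deriv) (use assms in auto)
  have alg: "z * (- z * J2 / (2 * n2)) = 2 * n1 * (J0 - J1)"
    if "J1 - J0 = z\<^sup>2 * J2 / (4 * n1 * n2)" "n1 > 0" "n2 > 0" for J0 J1 J2 n1 n2
  proof -
    have "2 * n1 * (J0 - J1) = - 2 * n1 * (z\<^sup>2 * J2 / (4 * n1 * n2))"
      unfolding that(1)[symmetric] by (simp add: algebra_simps)
    also have "\<dots> = z * (- z * J2 / (2 * n2))"
      using that(2,3) by (simp add: power2_eq_square)
    finally show ?thesis by simp
  qed
  show "z * (- z * normalized_bessel (\<nu> + 1 + 1) z / (2 * (\<nu> + 1 + 1))) =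
      2 * (\<nu> + 1) * (normalized_bessel \<nu> z - normalized_bessel (\<nu> + 1) z)"
    by (rule alg) (use bessel_series_recurrence[OF assms, of "z\<^sup>2"] assms in
      \<open>auto simp: normalized_bessel_eq_series add.assoc\<close>)
qed

lemma normalized_bessel_0:
  assumes "\<nu> \<ge> - 1 / 2"
  shows "normalized_bessel \<nu> 0 = 1"
  using powser_zero[of "bessel_coeff \<nu>"] assms
  by (simp add: normalized_bessel_eq_series bessel_series_def bessel_coeff_def)

lemma normalized_bessel_minus:
  assumes "\<nu> \<ge> - 1 / 2"
  shows "normalized_bessel \<nu> (- z) = normalized_bessel \<nu> z"
  using assms by (simp add: normalized_bessel_eq_series)

text \<open>The left-hand side is the squared modulus of the Dunkl kernel; its derivative is
  \<open>- 2 (2 \<nu> + 1) z (j\<^bsub>\<nu>+1\<^esub>(z) / (2 \<nu> + 2))\<^sup>2\<close>, hence it decreases on the positive half line.\<close>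

lemma normalized_bessel_energy:
  assumes "\<nu> \<ge> - 1 / 2"
  shows "(normalized_bessel \<nu> z)\<^sup>2 + (z * normalized_bessel (\<nu> + 1) z / (2 * (\<nu> + 1)))\<^sup>2 \<le> 1"
proof -
  define F where "F z = (normalized_bessel \<nu> z)\<^sup>2 + (z * normalized_bessel (\<nu> + 1) z / (2 * (\<nu> + 1)))\<^sup>2"
    for z
  have n0: "\<nu> + 1 > 0" using assms by auto
  have D: "(F has_real_derivative
      - 2 * (2 * \<nu> + 1) * z * (normalized_bessel (\<nu> + 1) z / (2 * (\<nu> + 1)))\<^sup>2) (at z)" for z
  proof -
    obtain d where d: "(normalized_bessel (\<nu> + 1) has_real_derivative d) (at z)"
      "z * d = 2 * (\<nu> + 1) * (normalized_bessel \<nu> z - normalized_bessel (\<nu> + 1) z)"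
      using normalized_bessel_deriv_Suc[OF assms] by blast
    \<comment> \<open>Let B = z j_(\<nu>+1) / (2 (\<nu> + 1)), so that j_\<nu>' = - B. Then B' is
      j_\<nu> minus a multiple of 2 \<nu> + 1, and in the derivative of j_\<nu>^2 + B^2 the terms in
      j_\<nu> B cancel.\<close>
    have e: "(normalized_bessel (\<nu> + 1) z + z * d) / (2 * (\<nu> + 1)) =
        normalized_bessel \<nu> z - (2 * \<nu> + 1) * (normalized_bessel (\<nu> + 1) z / (2 * (\<nu> + 1)))"
      unfolding d(2) using n0 by (simp add: field_simps)
    have "((\<lambda>z. z * normalized_bessel (\<nu> + 1) z / (2 * (\<nu> + 1))) has_real_derivative
        (normalized_bessel (\<nu> + 1) z + z * d) / (2 * (\<nu> + 1))) (at z)"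
      using n0 by (auto intro!: derivative_eq_intros d(1))
    note B = this[unfolded e]
    show ?thesis unfolding F_def
      by (rule DERIV_cong[OF DERIV_add[OF DERIV_power[OF normalized_bessel_deriv[OF assms], of 2]
              DERIV_power[OF B, of 2]]])
        (simp add: algebra_simps power2_eq_square diff_divide_distrib add_divide_distrib)
  qed
  have pos: "F z \<le> 1" if "z \<ge> 0" for z
  proof -
    have "F z \<le> F 0"
      by (rule DERIV_nonpos_imp_nonincreasing[OF that])
        (use D assms in \<open>fastforce intro!: mult_nonpos_nonneg mult_nonneg_nonneg\<close>)
    also have "F 0 = 1" using assms by (simp add: F_def normalized_bessel_0)
    finally show ?thesis .
  qed
  have "F z = F \<bar>z\<bar>" using assms by (auto simp: F_def normalized_bessel_minus abs_if)
  with pos[of "\<bar>z\<bar>"] show ?thesis by (simp add: F_def)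
qed

text \<open>The second quantity is |j_\<nu>'(z)|. Its bound dominates the x-derivative of the kernel
  when differentiating under the integral.\<close>

lemma normalized_bessel_bound:
  assumes "\<nu> \<ge> - 1 / 2"
  shows "\<bar>normalized_bessel \<nu> z\<bar> \<le> 1"
    and "\<bar>z * normalized_bessel (\<nu> + 1) z / (2 * (\<nu> + 1))\<bar> \<le> 1"
proof -
  have "a\<^sup>2 \<le> 1" if "a\<^sup>2 + b\<^sup>2 \<le> 1" for a b :: real
    using that zero_le_power2[of b] by linarith
  thus "\<bar>normalized_bessel \<nu> z\<bar> \<le> 1" "\<bar>z * normalized_bessel (\<nu> + 1) z / (2 * (\<nu> + 1))\<bar> \<le> 1"
    unfolding abs_square_le_1[symmetric]
    using normalized_bessel_energy[OF assms, of z] by (metis, metis add.commute)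
qed

lemma continuous_normalized_bessel [continuous_intros]:
  assumes "\<nu> \<ge> - 1 / 2" "continuous_on S g"
  shows "continuous_on S (\<lambda>x. normalized_bessel \<nu> (g x))"
proof -
  have "continuous_on UNIV (normalized_bessel \<nu>)"
    by (intro continuous_at_imp_continuous_on ballI DERIV_isCont) (rule normalized_bessel_deriv[OF assms(1)])
  from continuous_on_compose2[OF this assms(2)] show ?thesis by auto
qed

subsection \<open>Families of functions depending tamely on a Schwartz function\<close>

type_synonym family = "(real \<Rightarrow> complex) \<Rightarrow> real \<Rightarrow> real \<Rightarrow> complex"

definition schwartz_norm :: "nat \<Rightarrow> (real \<Rightarrow> complex) \<Rightarrow> real" where
  "schwartz_norm N f = (\<Sum>l\<le>N. \<Sum>n\<le>N. schwartz_seminorm l n f)"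

text \<open>The usual continuity criterion for seminorms on the Schwartz space, kept as a predicate
  so that constants need not be tracked. A single index N suffices because
  \<open>schwartz_norm\<close> increases with N on Schwartz functions.\<close>

definition gauge_fun :: "((real \<Rightarrow> complex) \<Rightarrow> real) \<Rightarrow> bool" where
  "gauge_fun g \<longleftrightarrow> (\<exists>C N. 0 \<le> C \<and> (\<forall>f\<in>schwartz_space. g f \<le> C * schwartz_norm N f))"

definition gauged :: "family \<Rightarrow> bool" where
  "gauged A \<longleftrightarrow> (\<exists>g. gauge_fun g \<and> (\<forall>f\<in>schwartz_space. \<forall>x y. norm (A f x y) \<le> g f))"

definition partials :: "family \<Rightarrow> family \<Rightarrow> family \<Rightarrow> bool" where
  "partials A A1 A2 \<longleftrightarrow> (\<forall>f\<in>schwartz_space. \<forall>x y.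
     ((\<lambda>s. A f s y) has_vector_derivative A1 f x y) (at x) \<and>
     ((\<lambda>t. A f x t) has_vector_derivative A2 f x y) (at y))"

definition gauged_continuous :: "nat set \<Rightarrow> family \<Rightarrow> bool" where
  "gauged_continuous E A \<longleftrightarrow>
     (\<forall>f\<in>schwartz_space. continuous_on UNIV (\<lambda>z. A f (fst z) (snd z))) \<and>
     (\<forall>p\<in>E. gauged (\<lambda>f x y. of_real (y ^ p) * A f x y))"

text \<open>The exponent set \<open>E\<close> is \<open>{0}\<close> for bounded families, a class closed under averaging in \<open>y\<close>,
  and \<open>UNIV\<close> for families with rapid decay in \<open>y\<close>. The variable \<open>x\<close> is only a parameter;
  a function of one variable is encoded as a family that ignores \<open>x\<close>.\<close>

fun smooth_family :: "nat set \<Rightarrow> nat \<Rightarrow> family \<Rightarrow> bool" where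
  "smooth_family E 0 A \<longleftrightarrow> gauged_continuous E A"
| "smooth_family E (Suc N) A \<longleftrightarrow> gauged_continuous E A \<and>
     (\<exists>A1 A2. partials A A1 A2 \<and> smooth_family E N A1 \<and> smooth_family E N A2)"

definition tame :: "family \<Rightarrow> bool" where
  "tame A \<longleftrightarrow> (\<forall>N. smooth_family UNIV N A)"

definition joint_partials ::
    "(real \<Rightarrow> real \<Rightarrow> complex) \<Rightarrow> (real \<Rightarrow> real \<Rightarrow> complex) \<Rightarrow> (real \<Rightarrow> real \<Rightarrow> complex) \<Rightarrow> bool" where
  "joint_partials m m1 m2 \<longleftrightarrow> (\<forall>x y.
     ((\<lambda>s. m s y) has_vector_derivative m1 x y) (at x) \<and>
     ((\<lambda>t. m x t) has_vector_derivative m2 x y) (at y))"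

definition poly_bounded :: "(real \<Rightarrow> real \<Rightarrow> complex) \<Rightarrow> bool" where
  "poly_bounded m \<longleftrightarrow> continuous_on UNIV (\<lambda>z. m (fst z) (snd z)) \<and>
     (\<exists>C q. \<forall>x y. norm (m x y) \<le> C * (1 + \<bar>y\<bar>) ^ q)"

text \<open>The degree of growth may change from one derivative to the next: a chirp gains a power
  of y at each differentiation. All bounds are uniform in x.\<close>

fun multiplier :: "nat \<Rightarrow> (real \<Rightarrow> real \<Rightarrow> complex) \<Rightarrow> bool" where
  "multiplier 0 m \<longleftrightarrow> poly_bounded m"
| "multiplier (Suc N) m \<longleftrightarrow> poly_bounded m \<and>
     (\<exists>m1 m2. joint_partials m m1 m2 \<and> multiplier N m1 \<and> multiplier N m2)"

section \<open>Seminorm estimates and gauges\<close>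

lemma schwartz_seminorm_bdd:
  assumes "f \<in> schwartz_space"
  shows "bdd_above (range (\<lambda>x. cmod (of_real (x ^ l) * iter_deriv n f x)))"
proof -
  have "bounded (range (\<lambda>x. of_real (x ^ l) * iter_deriv n f x))"
    using assms unfolding schwartz_space_def by blast
  then obtain B where "\<forall>y\<in>range (\<lambda>x. of_real (x ^ l) * iter_deriv n f x). norm y \<le> B"
    unfolding bounded_iff by blast
  thus ?thesis by (intro bdd_aboveI2[of _ _ B]) blast
qed

lemma schwartz_seminorm_upper:
  "f \<in> schwartz_space \<Longrightarrow> cmod (of_real (x ^ l) * iter_deriv n f x) \<le> schwartz_seminorm l n f"
  unfolding schwartz_seminorm_def by (rule cSUP_upper[OF UNIV_I schwartz_seminorm_bdd])

lemma schwartz_seminorm_nonneg: "f \<in> schwartz_space \<Longrightarrow> 0 \<le> schwartz_seminorm l n f"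
  using schwartz_seminorm_upper[of f 0 l n] norm_ge_zero order_trans by blast

lemma schwartz_norm_mono:
  assumes "f \<in> schwartz_space" "N \<le> N'"
  shows "schwartz_norm N f \<le> schwartz_norm N' f"
proof -
  have "schwartz_norm N f \<le> (\<Sum>l\<le>N. \<Sum>n\<le>N'. schwartz_seminorm l n f)"
    unfolding schwartz_norm_def
    by (intro sum_mono sum_mono2) (use assms schwartz_seminorm_nonneg in auto)
  also have "\<dots> \<le> schwartz_norm N' f"
    unfolding schwartz_norm_def
    by (intro sum_mono2) (use assms schwartz_seminorm_nonneg in \<open>auto intro!: sum_nonneg\<close>)
  finally show ?thesis .
qed

lemma schwartz_seminorm_le_norm:
  assumes "f \<in> schwartz_space"
  shows "schwartz_seminorm l n f \<le> schwartz_norm (max l n) f"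
proof -
  have "schwartz_seminorm l n f \<le> (\<Sum>n\<le>max l n. schwartz_seminorm l n f)"
    by (rule member_le_sum) (use assms schwartz_seminorm_nonneg in auto)
  also have "\<dots> \<le> schwartz_norm (max l n) f"
    unfolding schwartz_norm_def
    using assms schwartz_seminorm_nonneg
    by (intro member_le_sum[of l _ "\<lambda>l. \<Sum>n\<le>k. schwartz_seminorm l n f" for k])
      (auto intro!: sum_nonneg)
  finally show ?thesis .
qed

lemma gauge_fun_le:
  assumes "gauge_fun g" "0 \<le> K" "\<And>f. f \<in> schwartz_space \<Longrightarrow> h f \<le> K * g f"
  shows "gauge_fun h"
proof -
  obtain C N where C: "0 \<le> C" "\<forall>f\<in>schwartz_space. g f \<le> C * schwartz_norm N f"
    using assms(1) unfolding gauge_fun_def by blast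
  have "h f \<le> (K * C) * schwartz_norm N f" if f: "f \<in> schwartz_space" for f
    using assms(3)[OF f] mult_left_mono[OF bspec[OF C(2) f] assms(2)] by (simp add: mult.assoc)
  thus ?thesis unfolding gauge_fun_def using C(1) assms(2)
    by (intro exI[of _ "K * C"] exI[of _ N]) auto
qed

lemma gauge_fun_add:
  assumes "gauge_fun g" "gauge_fun h"
  shows "gauge_fun (\<lambda>f. g f + h f)"
proof -
  obtain C N where C: "0 \<le> C" "\<forall>f\<in>schwartz_space. g f \<le> C * schwartz_norm N f"
    using assms(1) unfolding gauge_fun_def by blast
  obtain D K where D: "0 \<le> D" "\<forall>f\<in>schwartz_space. h f \<le> D * schwartz_norm K f"
    using assms(2) unfolding gauge_fun_def by blast
  have "g f + h f \<le> (C + D) * schwartz_norm (max N K) f" if f: "f \<in> schwartz_space" for f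
  proof -
    have "g f \<le> C * schwartz_norm (max N K) f"
      by (rule order_trans[OF bspec[OF C(2) f] mult_left_mono[OF schwartz_norm_mono[OF f] C(1)]]) simp
    moreover have "h f \<le> D * schwartz_norm (max N K) f"
      by (rule order_trans[OF bspec[OF D(2) f] mult_left_mono[OF schwartz_norm_mono[OF f] D(1)]]) simp
    ultimately show ?thesis by (simp add: distrib_right)
  qed
  thus ?thesis unfolding gauge_fun_def using C(1) D(1)
    by (intro exI[of _ "C + D"] exI[of _ "max N K"]) auto
qed

text \<open>Gauges bound a family at all points simultaneously, so the comparison may use values of
  A and B at points other than (x, y); reflections need this freedom.\<close>

lemma gauged_le2:
  assumes "gauged A" "gauged B" "0 \<le> K"
    and "\<And>f x y. f \<in> schwartz_space \<Longrightarrow>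
      \<exists>x' y' x'' y''. norm (D f x y) \<le> K * (norm (A f x' y') + norm (B f x'' y''))"
  shows "gauged D"
proof -
  obtain g where g: "gauge_fun g" "\<forall>f\<in>schwartz_space. \<forall>x y. norm (A f x y) \<le> g f"
    using assms(1) unfolding gauged_def by blast
  obtain h where h: "gauge_fun h" "\<forall>f\<in>schwartz_space. \<forall>x y. norm (B f x y) \<le> h f"
    using assms(2) unfolding gauged_def by blast
  have "gauge_fun (\<lambda>f. K * (g f + h f))"
    by (rule gauge_fun_le[OF gauge_fun_add[OF g(1) h(1)] assms(3)]) simp
  moreover have "norm (D f x y) \<le> K * (g f + h f)" if f: "f \<in> schwartz_space" for f x y
  proof -
    obtain x' y' x'' y'' where "norm (D f x y) \<le> K * (norm (A f x' y') + norm (B f x'' y''))"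
      using assms(4)[OF f] by blast
    also have "\<dots> \<le> K * (g f + h f)"
      by (intro mult_left_mono add_mono) (use g h f assms(3) in auto)
    finally show ?thesis .
  qed
  ultimately show ?thesis unfolding gauged_def by blast
qed

lemma gauged_le:
  assumes "gauged A" "0 \<le> K"
    and "\<And>f x y. f \<in> schwartz_space \<Longrightarrow> \<exists>x' y'. norm (D f x y) \<le> K * norm (A f x' y')"
  shows "gauged D"
proof (rule gauged_le2[OF assms(1,1,2)])
  fix f x y assume "f \<in> schwartz_space"
  from assms(3)[OF this, of x y] obtain x' y' where "norm (D f x y) \<le> K * norm (A f x' y')" by blast
  also have "\<dots> \<le> K * (norm (A f x' y') + norm (A f x' y'))"
    by (intro mult_left_mono) (use assms(2) in auto)
  finally show "\<exists>x' y' x'' y''. norm (D f x y) \<le> K * (norm (A f x' y') + norm (A f x'' y''))"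
    by blast
qed

lemma gauged_zero: "gauged (\<lambda>f x y. 0)"
  unfolding gauged_def gauge_fun_def
  by (rule exI[of _ "\<lambda>_. 0"], rule conjI, rule exI[of _ 0]) auto

section \<open>Closure properties of smooth families\<close>

lemma smooth_family_base: "smooth_family E N A \<Longrightarrow> gauged_continuous E A"
  by (cases N) auto

lemma smooth_family_Suc_D: "smooth_family E (Suc N) A \<Longrightarrow> smooth_family E N A"
proof (induction N arbitrary: A)
  case 0
  thus ?case using smooth_family_base by simp
next
  case (Suc N)
  from Suc.prems obtain A1 A2 where "gauged_continuous E A" "partials A A1 A2"
    "smooth_family E (Suc N) A1" "smooth_family E (Suc N) A2"
    unfolding smooth_family.simps(2)[of E "Suc N"] by blast
  with Suc.IH show ?case unfolding smooth_family.simps(2)[of E N] by blast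
qed

lemma smooth_family_cong:
  assumes "\<And>f x y. f \<in> schwartz_space \<Longrightarrow> A f x y = B f x y" "smooth_family E N A"
  shows "smooth_family E N B"
proof -
  have "gauged_continuous E A \<longleftrightarrow> gauged_continuous E B"
    using assms(1) by (simp add: gauged_continuous_def gauged_def)
  moreover have "partials A A1 A2 \<longleftrightarrow> partials B A1 A2" for A1 A2
    using assms(1) by (simp add: partials_def)
  ultimately show ?thesis using assms(2) by (cases N) auto
qed

lemma smooth_family_mono: "smooth_family E N A \<Longrightarrow> E' \<subseteq> E \<Longrightarrow> smooth_family E' N A"
proof (induction N arbitrary: A)
  case (Suc N)
  from Suc.prems(1) obtain A1 A2 where "gauged_continuous E A" "partials A A1 A2"
    "smooth_family E N A1" "smooth_family E N A2"
    unfolding smooth_family.simps by blast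
  moreover from this(1) Suc.prems(2) have "gauged_continuous E' A"
    unfolding gauged_continuous_def by blast
  ultimately show ?case unfolding smooth_family.simps using Suc.IH Suc.prems(2) by blast
qed (auto simp: gauged_continuous_def)

lemma continuous_on_pair_comp:
  assumes "continuous_on UNIV (\<lambda>z. F (fst z) (snd z))" "continuous_on S u" "continuous_on S v"
  shows "continuous_on S (\<lambda>z. F (u z) (v z))"
  using continuous_on_compose2[OF assms(1) continuous_on_Pair[OF assms(2,3)]] by simp

lemma has_vector_derivative_comp_mult:
  fixes F :: "real \<Rightarrow> complex"
  assumes "(F has_vector_derivative D) (at (c * s))"
  shows "((\<lambda>s. F (c * s)) has_vector_derivative of_real c * D) (at s)"
proof -
  have "((\<lambda>s. c * s) has_vector_derivative c) (at s)"
    by (auto intro!: derivative_eq_intros simp: has_real_derivative_iff_has_vector_derivative[symmetric])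
  from vector_diff_chain_at[OF this assms] show ?thesis
    by (simp add: o_def scaleR_conv_of_real)
qed

lemma smooth_family_add:
  assumes "smooth_family E N A" "smooth_family E N B"
  shows "smooth_family E N (\<lambda>f x y. A f x y + B f x y)"
  using assms
proof (induction N arbitrary: A B)
  case 0
  show ?case unfolding smooth_family.simps gauged_continuous_def
  proof (intro conjI ballI)
    fix p assume "p \<in> E"
    hence "gauged (\<lambda>f x y. of_real (y ^ p) * A f x y)" "gauged (\<lambda>f x y. of_real (y ^ p) * B f x y)"
      using 0 by (auto simp: gauged_continuous_def)
    thus "gauged (\<lambda>f x y. of_real (y ^ p) * (A f x y + B f x y))"
    proof (rule gauged_le2[where K=1])
      fix f x y
      show "\<exists>x' y' x'' y''. norm (of_real (y ^ p) * (A f x y + B f x y)) \<le>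
          1 * (norm (of_real (y' ^ p) * A f x' y') + norm (of_real (y'' ^ p) * B f x'' y''))"
        by (rule exI[of _ x], rule exI[of _ y], rule exI[of _ x], rule exI[of _ y])
          (simp add: distrib_left norm_triangle_ineq del: norm_mult)
    qed simp
  qed (use 0 in \<open>auto simp: gauged_continuous_def intro!: continuous_intros\<close>)
next
  case (Suc N)
  obtain A1 A2 B1 B2 where
    "partials A A1 A2" "smooth_family E N A1" "smooth_family E N A2"
    "partials B B1 B2" "smooth_family E N B1" "smooth_family E N B2"
    using Suc.prems by auto
  hence "partials (\<lambda>f x y. A f x y + B f x y) (\<lambda>f x y. A1 f x y + B1 f x y) (\<lambda>f x y. A2 f x y + B2 f x y)"
    "smooth_family E N (\<lambda>f x y. A1 f x y + B1 f x y)" "smooth_family E N (\<lambda>f x y. A2 f x y + B2 f x y)"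
    by (auto simp: partials_def intro!: has_vector_derivative_add Suc.IH)
  moreover have "gauged_continuous E (\<lambda>f x y. A f x y + B f x y)"
    using Suc.IH[THEN smooth_family_base] Suc.prems[THEN smooth_family_Suc_D] by blast
  ultimately show ?case by auto
qed

lemma smooth_family_scale:
  assumes "smooth_family E N A"
  shows "smooth_family E N (\<lambda>f x y. c * A f x y)"
  using assms
proof (induction N arbitrary: A)
  case 0
  show ?case unfolding smooth_family.simps gauged_continuous_def
  proof (intro conjI ballI)
    fix p assume "p \<in> E"
    hence "gauged (\<lambda>f x y. of_real (y ^ p) * A f x y)"
      using 0 by (auto simp: gauged_continuous_def)
    thus "gauged (\<lambda>f x y. of_real (y ^ p) * (c * A f x y))"
    proof (rule gauged_le[where K="norm c"])
      fix f x y
      show "\<exists>x' y'. norm (of_real (y ^ p) * (c * A f x y)) \<le> norm c * norm (of_real (y' ^ p) * A f x' y')"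
        by (rule exI[of _ x], rule exI[of _ y]) (simp add: norm_mult)
    qed simp
  qed (use 0 in \<open>auto simp: gauged_continuous_def intro!: continuous_intros\<close>)
next
  case (Suc N)
  obtain A1 A2 where
    "partials A A1 A2" "smooth_family E N A1" "smooth_family E N A2"
    using Suc.prems by auto
  hence "partials (\<lambda>f x y. c * A f x y) (\<lambda>f x y. c * A1 f x y) (\<lambda>f x y. c * A2 f x y)"
    "smooth_family E N (\<lambda>f x y. c * A1 f x y)" "smooth_family E N (\<lambda>f x y. c * A2 f x y)"
    by (auto simp: partials_def intro!: has_vector_derivative_mult_right Suc.IH)
  moreover have "gauged_continuous E (\<lambda>f x y. c * A f x y)"
    using Suc.IH[THEN smooth_family_base] Suc.prems[THEN smooth_family_Suc_D] by blast
  ultimately show ?case by auto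
qed

lemma smooth_family_reflect:
  assumes "smooth_family E N A"
  shows "smooth_family E N (\<lambda>f x y. A f x (- y))"
  using assms
proof (induction N arbitrary: A)
  case 0
  show ?case unfolding smooth_family.simps gauged_continuous_def
  proof (intro conjI ballI)
    fix p assume "p \<in> E"
    hence "gauged (\<lambda>f x y. of_real (y ^ p) * A f x y)"
      using 0 by (auto simp: gauged_continuous_def)
    thus "gauged (\<lambda>f x y. of_real (y ^ p) * (A f x (- y)))"
    proof (rule gauged_le[where K=1])
      fix f x y
      show "\<exists>x' y'. norm (of_real (y ^ p) * A f x (- y)) \<le> 1 * norm (of_real (y' ^ p) * A f x' y')"
        by (rule exI[of _ x], rule exI[of _ "- y"]) (simp add: norm_mult norm_power)
    qed simp
  next
    fix f assume "f \<in> schwartz_space"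
    hence "continuous_on UNIV (\<lambda>z. A f (fst z) (snd z))"
      using 0 by (auto simp: gauged_continuous_def)
    thus "continuous_on UNIV (\<lambda>z. A f (fst z) (- snd z))"
      by (rule continuous_on_pair_comp) (intro continuous_intros)+
  qed
next
  case (Suc N)
  obtain A1 A2 where A:
    "partials A A1 A2" "smooth_family E N A1" "smooth_family E N A2"
    using Suc.prems by auto
  have "partials (\<lambda>f x y. A f x (- y)) (\<lambda>f x y. A1 f x (- y)) (\<lambda>f x y. - 1 * A2 f x (- y))"
    unfolding partials_def
  proof (intro ballI allI conjI)
    fix f x y assume f: "f \<in> schwartz_space"
    show "((\<lambda>s. A f s (- y)) has_vector_derivative A1 f x (- y)) (at x)"
      using A(1) f by (auto simp: partials_def)
    have "((\<lambda>t. A f x t) has_vector_derivative A2 f x (- y)) (at (- 1 * y))"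
      using A(1) f by (auto simp: partials_def)
    from has_vector_derivative_comp_mult[OF this]
    show "((\<lambda>t. A f x (- t)) has_vector_derivative - 1 * A2 f x (- y)) (at y)"
      by simp
  qed
  moreover have "smooth_family E N (\<lambda>f x y. A1 f x (- y))"
    "smooth_family E N (\<lambda>f x y. - 1 * A2 f x (- y))"
    by (intro smooth_family_scale Suc.IH A)+
  moreover have "gauged_continuous E (\<lambda>f x y. A f x (- y))"
    using Suc.IH[THEN smooth_family_base] Suc.prems[THEN smooth_family_Suc_D] by blast
  ultimately show ?case unfolding smooth_family.simps by blast
qed

text \<open>Distinguishing t <= 1 from t > 1 replaces the weight (1 + t)^q by two pure powers, so
  that a factor of polynomial growth costs only the moments p and p + q of a family.\<close>

lemma one_plus_power_le: "(1 + t) ^ q \<le> 2 ^ q * (1 + t ^ q)" if "0 \<le> t" for t :: real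
proof (cases "t \<le> 1")
  case True
  have "(1 + t) ^ q \<le> 2 ^ q" by (rule power_mono) (use that True in auto)
  also have "\<dots> \<le> 2 ^ q * (1 + t ^ q)" using that by simp
  finally show ?thesis .
next
  case False
  have "(1 + t) ^ q \<le> (2 * t) ^ q" by (rule power_mono) (use that False in auto)
  also have "\<dots> \<le> 2 ^ q * (1 + t ^ q)" by (simp add: power_mult_distrib)
  finally show ?thesis .
qed

section \<open>Multipliers of polynomial growth\<close>

lemma multiplier_base: "multiplier N m \<Longrightarrow> poly_bounded m"
  by (cases N) auto

lemma multiplier_Suc_D: "multiplier (Suc N) m \<Longrightarrow> multiplier N m"
proof (induction N arbitrary: m)
  case 0
  thus ?case using multiplier_base by simp
next
  case (Suc N)
  from Suc.prems obtain m1 m2 where "poly_bounded m" "joint_partials m m1 m2"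
    "multiplier (Suc N) m1" "multiplier (Suc N) m2"
    unfolding multiplier.simps(2)[of "Suc N"] by blast
  with Suc.IH show ?case unfolding multiplier.simps(2)[of N] by blast
qed

lemma poly_bounded_add:
  assumes "poly_bounded m" "poly_bounded n"
  shows "poly_bounded (\<lambda>x y. m x y + n x y)"
proof -
  obtain C q where m: "continuous_on UNIV (\<lambda>z. m (fst z) (snd z))"
    "\<And>x y. norm (m x y) \<le> C * (1 + \<bar>y\<bar>) ^ q"
    using assms(1) unfolding poly_bounded_def by blast
  obtain D r where n: "continuous_on UNIV (\<lambda>z. n (fst z) (snd z))"
    "\<And>x y. norm (n x y) \<le> D * (1 + \<bar>y\<bar>) ^ r"
    using assms(2) unfolding poly_bounded_def by blast
  have "0 \<le> C" "0 \<le> D"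
    using order_trans[OF norm_ge_zero m(2)[of 0 0]] order_trans[OF norm_ge_zero n(2)[of 0 0]] by auto
  have "norm (m x y + n x y) \<le> (C + D) * (1 + \<bar>y\<bar>) ^ (q + r)" for x y
  proof -
    have "norm (m x y + n x y) \<le> C * (1 + \<bar>y\<bar>) ^ q + D * (1 + \<bar>y\<bar>) ^ r"
      using norm_triangle_ineq m(2) n(2) add_mono order_trans by metis
    also have "\<dots> \<le> C * (1 + \<bar>y\<bar>) ^ (q + r) + D * (1 + \<bar>y\<bar>) ^ (q + r)"
      by (intro add_mono mult_left_mono power_increasing) (use \<open>0 \<le> C\<close> \<open>0 \<le> D\<close> in auto)
    finally show ?thesis by (simp add: distrib_right)
  qed
  with continuous_on_add[OF m(1) n(1)] show ?thesis unfolding poly_bounded_def by blast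
qed

lemma poly_bounded_mult:
  assumes "poly_bounded m" "poly_bounded n"
  shows "poly_bounded (\<lambda>x y. m x y * n x y)"
proof -
  obtain C q where m: "continuous_on UNIV (\<lambda>z. m (fst z) (snd z))"
    "\<And>x y. norm (m x y) \<le> C * (1 + \<bar>y\<bar>) ^ q"
    using assms(1) unfolding poly_bounded_def by blast
  obtain D r where n: "continuous_on UNIV (\<lambda>z. n (fst z) (snd z))"
    "\<And>x y. norm (n x y) \<le> D * (1 + \<bar>y\<bar>) ^ r"
    using assms(2) unfolding poly_bounded_def by blast
  have "norm (m x y * n x y) \<le> (C * D) * (1 + \<bar>y\<bar>) ^ (q + r)" for x y
    using mult_mono[OF m(2) n(2) order_trans[OF norm_ge_zero m(2)] norm_ge_zero, of x y x y]
    by (simp add: norm_mult power_add mult_ac)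
  with continuous_on_mult[OF m(1) n(1)] show ?thesis unfolding poly_bounded_def by blast
qed

lemma multiplier_add:
  "multiplier N m \<Longrightarrow> multiplier N n \<Longrightarrow> multiplier N (\<lambda>x y. m x y + n x y)"
proof (induction N arbitrary: m n)
  case (Suc N)
  obtain m1 m2 n1 n2 where
    m: "joint_partials m m1 m2" "multiplier N m1" "multiplier N m2" and
    n: "joint_partials n n1 n2" "multiplier N n1" "multiplier N n2"
    using Suc.prems by auto
  have "joint_partials (\<lambda>x y. m x y + n x y) (\<lambda>x y. m1 x y + n1 x y) (\<lambda>x y. m2 x y + n2 x y)"
    using m(1) n(1) by (auto simp: joint_partials_def intro: has_vector_derivative_add)
  thus ?case
    using Suc.IH[OF m(2) n(2)] Suc.IH[OF m(3) n(3)]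
      poly_bounded_add[OF Suc.prems[THEN multiplier_base]]
    unfolding multiplier.simps by blast
qed (simp add: poly_bounded_add)

lemma multiplier_mult:
  "multiplier N m \<Longrightarrow> multiplier N n \<Longrightarrow> multiplier N (\<lambda>x y. m x y * n x y)"
proof (induction N arbitrary: m n)
  case (Suc N)
  obtain m1 m2 n1 n2 where
    m: "joint_partials m m1 m2" "multiplier N m1" "multiplier N m2" and
    n: "joint_partials n n1 n2" "multiplier N n1" "multiplier N n2"
    using Suc.prems by auto
  have "joint_partials (\<lambda>x y. m x y * n x y) (\<lambda>x y. m x y * n1 x y + m1 x y * n x y)
      (\<lambda>x y. m x y * n2 x y + m2 x y * n x y)"
    using m(1) n(1) by (auto simp: joint_partials_def intro: has_vector_derivative_mult)
  moreover have "multiplier N (\<lambda>x y. m x y * n1 x y + m1 x y * n x y)"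
    "multiplier N (\<lambda>x y. m x y * n2 x y + m2 x y * n x y)"
    by (intro multiplier_add Suc.IH m n Suc.prems[THEN multiplier_Suc_D])+
  ultimately show ?case
    using poly_bounded_mult[OF Suc.prems[THEN multiplier_base]]
    unfolding multiplier.simps by blast
qed (simp add: poly_bounded_mult)

lemma multiplier_const: "multiplier N (\<lambda>x y. c)"
proof (induction N arbitrary: c)
  case 0
  show ?case unfolding multiplier.simps poly_bounded_def
    by (intro conjI exI[of _ "norm c"] exI[of _ 0]) auto
next
  case (Suc N)
  have "joint_partials (\<lambda>x y. c) (\<lambda>x y. 0) (\<lambda>x y. 0)" by (simp add: joint_partials_def)
  with Suc.IH multiplier_base[OF Suc.IH] show ?case unfolding multiplier.simps by blast
qed

lemma multiplier_y: "multiplier N (\<lambda>x y. of_real y)"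
proof -
  have "poly_bounded (\<lambda>x y. of_real y)"
    unfolding poly_bounded_def
    by (intro conjI exI[of _ 1] exI[of _ 1]) (auto intro!: continuous_intros)
  moreover have "joint_partials (\<lambda>x y. of_real y) (\<lambda>x y. 0) (\<lambda>x y. 1)"
    using has_vector_derivative_of_real[OF DERIV_ident] by (auto simp: joint_partials_def)
  ultimately show ?thesis using multiplier_const by (cases N) (simp, auto)
qed

lemma multiplier_power: "multiplier N m \<Longrightarrow> multiplier N (\<lambda>x y. m x y ^ p)"
  by (induction p) (simp_all add: multiplier_const multiplier_mult)

lemma multiplier_y_power: "multiplier N (\<lambda>x y. of_real (y ^ p))"
  using multiplier_power[OF multiplier_y] by simp

text \<open>The y-derivative is the chirp itself times 2 i r y, so the induction closes with the
  product rule for multipliers.\<close>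

lemma multiplier_chirp: "multiplier N (\<lambda>x y. exp (\<i> * of_real (r * y\<^sup>2)))"
proof (induction N)
  case 0
  show ?case unfolding multiplier.simps poly_bounded_def
    by (intro conjI exI[of _ 1] exI[of _ 0]) (auto intro!: continuous_intros)
next
  case (Suc N)
  have "((\<lambda>t. exp (\<i> * of_real (r * t\<^sup>2))) has_vector_derivative
      (2 * \<i> * of_real r * of_real y) * exp (\<i> * of_real (r * y\<^sup>2))) (at y)" for y :: real
  proof -
    have "((\<lambda>z. exp (\<i> * (of_real r * z\<^sup>2))) has_field_derivative
        (2 * \<i> * of_real r * of_real y) * exp (\<i> * (of_real r * (of_real y)\<^sup>2))) (at (of_real y))"
      by (auto intro!: derivative_eq_intros)
    from has_vector_derivative_real_field[OF this] show ?thesis by simp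
  qed
  hence "joint_partials (\<lambda>x y. exp (\<i> * of_real (r * y\<^sup>2))) (\<lambda>x y. 0)
      (\<lambda>x y. (2 * \<i> * of_real r * of_real y) * exp (\<i> * of_real (r * y\<^sup>2)))"
    by (simp add: joint_partials_def)
  moreover have "multiplier N (\<lambda>x y. (2 * \<i> * of_real r * of_real y) * exp (\<i> * of_real (r * y\<^sup>2)))"
    by (intro multiplier_mult multiplier_const multiplier_y Suc.IH)
  ultimately show ?case
    using multiplier_base[OF Suc.IH] multiplier_const unfolding multiplier.simps by blast
qed

text \<open>Multiplication shifts the exponent p to p + q with q unknown in advance, hence the
  exponent set \<open>UNIV\<close>.\<close>

lemma smooth_family_multiplier:
  assumes "multiplier N m" "smooth_family UNIV N A"
  shows "smooth_family UNIV N (\<lambda>f x y. m x y * A f x y)"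
  using assms
proof (induction N arbitrary: m A)
  case 0
  then obtain C q where m: "continuous_on UNIV (\<lambda>z. m (fst z) (snd z))"
    "\<And>x y. norm (m x y) \<le> C * (1 + \<bar>y\<bar>) ^ q"
    unfolding multiplier.simps poly_bounded_def by blast
  have C: "0 \<le> C" using order_trans[OF norm_ge_zero m(2)[of 0 0]] by simp
  show ?case unfolding smooth_family.simps gauged_continuous_def
  proof (intro conjI ballI)
    fix p :: nat
    have "gauged (\<lambda>f x y. of_real (y ^ p) * A f x y)" "gauged (\<lambda>f x y. of_real (y ^ (p + q)) * A f x y)"
      using 0(2) by (auto simp: gauged_continuous_def)
    thus "gauged (\<lambda>f x y. of_real (y ^ p) * (m x y * A f x y))"
    proof (rule gauged_le2[where K="C * 2 ^ q"])
      fix f x y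
      have "norm (of_real (y ^ p) * (m x y * A f x y)) = norm (m x y) * (\<bar>y\<bar> ^ p * norm (A f x y))"
        by (simp add: norm_mult norm_power)
      also have "\<dots> \<le> (C * (2 ^ q * (1 + \<bar>y\<bar> ^ q))) * (\<bar>y\<bar> ^ p * norm (A f x y))"
        by (intro mult_right_mono order_trans[OF m(2)] mult_left_mono one_plus_power_le) (use C in auto)
      also have "\<dots> = C * 2 ^ q * (norm (of_real (y ^ p) * A f x y) + norm (of_real (y ^ (p + q)) * A f x y))"
        by (simp add: norm_mult norm_power power_add algebra_simps)
      finally show "\<exists>x' y' x'' y''. norm (of_real (y ^ p) * (m x y * A f x y)) \<le>
          C * 2 ^ q * (norm (of_real (y' ^ p) * A f x' y') + norm (of_real (y'' ^ (p + q)) * A f x'' y''))"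
        by blast
    qed (use C in simp)
  qed (use 0 m(1) in \<open>auto simp: gauged_continuous_def intro!: continuous_intros\<close>)
next
  case (Suc N)
  obtain A1 A2 where A: "partials A A1 A2" "smooth_family UNIV N A1" "smooth_family UNIV N A2"
    using Suc.prems by auto
  obtain m1 m2 where m: "joint_partials m m1 m2" "multiplier N m1" "multiplier N m2"
    using Suc.prems by auto
  have mN: "multiplier N m" by (rule multiplier_Suc_D[OF Suc.prems(1)])
  have AN: "smooth_family UNIV N A" by (rule smooth_family_Suc_D[OF Suc.prems(2)])
  have "partials (\<lambda>f x y. m x y * A f x y) (\<lambda>f x y. m x y * A1 f x y + m1 x y * A f x y)
      (\<lambda>f x y. m x y * A2 f x y + m2 x y * A f x y)"
    using m(1) A(1) by (auto simp: partials_def joint_partials_def intro!: has_vector_derivative_mult)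
  moreover have "smooth_family UNIV N (\<lambda>f x y. m x y * A1 f x y + m1 x y * A f x y)"
    "smooth_family UNIV N (\<lambda>f x y. m x y * A2 f x y + m2 x y * A f x y)"
    by (intro smooth_family_add Suc.IH A m AN mN)+
  moreover have "gauged_continuous UNIV (\<lambda>f x y. m x y * A f x y)"
    by (rule smooth_family_base[OF Suc.IH[OF mN AN]])
  ultimately show ?case unfolding smooth_family.simps by blast
qed

text \<open>Averaging destroys decay, since t y can be small while y is large; only the exponent 0
  is preserved. The power t^n is carried along because every y-derivative produces another factor
  t.\<close>

lemma smooth_family_average:
  assumes "smooth_family {0} N A"
  shows "smooth_family {0} N (\<lambda>f x y. integral {0..1} (\<lambda>t. of_real (t ^ n) * A f x (t * y)))"
  using assms
proof (induction N arbitrary: A n)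
  case 0
  show ?case unfolding smooth_family.simps gauged_continuous_def
  proof (intro conjI ballI)
    fix f assume f: "f \<in> schwartz_space"
    have cA: "continuous_on UNIV (\<lambda>z. A f (fst z) (snd z))"
      using 0 f by (auto simp: gauged_continuous_def)
    have "continuous_on (UNIV \<times> cbox 0 1)
        (\<lambda>(z, t). of_real (t ^ n) * A f (fst z) (t * snd z))"
      unfolding case_prod_beta
      by (intro continuous_intros continuous_on_pair_comp[OF cA])
    from integral_continuous_on_param[OF this]
    show "continuous_on UNIV
        (\<lambda>z. integral {0..1} (\<lambda>t. of_real (t ^ n) * A f (fst z) (t * snd z)))"
      by simp
  next
    fix p :: nat assume p: "p \<in> {0}"
    have "gauged (\<lambda>f x y. A f x y)" using 0 by (auto simp: gauged_continuous_def)
    then obtain g where g: "gauge_fun g" "\<forall>f\<in>schwartz_space. \<forall>x y. norm (A f x y) \<le> g f"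
      unfolding gauged_def by blast
    have "norm (integral {0..1} (\<lambda>t. of_real (t ^ n) * A f x (t * y))) \<le> g f"
      if f: "f \<in> schwartz_space" for f x y
    proof -
      have cA: "continuous_on UNIV (\<lambda>z. A f (fst z) (snd z))"
        using 0 f by (auto simp: gauged_continuous_def)
      have "norm (integral {0..1} (\<lambda>t. of_real (t ^ n) * A f x (t * y))) \<le> g f * (1 - 0)"
      proof (rule integral_bound)
        show "continuous_on {0..1} (\<lambda>t. of_real (t ^ n) * A f x (t * y))"
          by (intro continuous_intros continuous_on_pair_comp[OF cA])
      next
        fix t :: real assume t: "t \<in> {0..1}"
        have "norm (of_real (t ^ n) * A f x (t * y)) = t ^ n * norm (A f x (t * y))"
          using t by (simp add: norm_mult norm_power)
        also have "\<dots> \<le> 1 * g f"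
          by (intro mult_mono power_le_one) (use t g f in auto)
        finally show "norm (of_real (t ^ n) * A f x (t * y)) \<le> g f" by simp
      qed auto
      thus ?thesis by simp
    qed
    thus "gauged (\<lambda>f x y. of_real (y ^ p) * integral {0..1} (\<lambda>t. of_real (t ^ n) * A f x (t * y)))"
      using p g(1) unfolding gauged_def by auto
  qed
next
  case (Suc N)
  obtain A1 A2 where A: "partials A A1 A2" "smooth_family {0} N A1" "smooth_family {0} N A2"
    using Suc.prems by auto
  have "partials (\<lambda>f x y. integral {0..1} (\<lambda>t. of_real (t ^ n) * A f x (t * y)))
      (\<lambda>f x y. integral {0..1} (\<lambda>t. of_real (t ^ n) * A1 f x (t * y)))
      (\<lambda>f x y. integral {0..1} (\<lambda>t. of_real (t ^ Suc n) * A2 f x (t * y)))"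
    unfolding partials_def
  proof (intro ballI allI conjI)
    fix f x y assume f: "f \<in> schwartz_space"
    have c: "continuous_on UNIV (\<lambda>z. A f (fst z) (snd z))"
      "continuous_on UNIV (\<lambda>z. A1 f (fst z) (snd z))"
      "continuous_on UNIV (\<lambda>z. A2 f (fst z) (snd z))"
      using smooth_family_base[OF Suc.prems] A(2,3)[THEN smooth_family_base] f
      by (auto simp: gauged_continuous_def)
    have int: "(\<lambda>t. of_real (t ^ n) * A f x (t * y)) integrable_on cbox 0 1" for x y
      by (intro integrable_continuous continuous_intros continuous_on_pair_comp[OF c(1)])
    have "((\<lambda>s. integral (cbox 0 1) (\<lambda>t. of_real (t ^ n) * A f s (t * y))) has_vector_derivative
        integral (cbox 0 1) (\<lambda>t. of_real (t ^ n) * A1 f x (t * y))) (at x within UNIV)"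
    proof (rule leibniz_rule_vector_derivative)
      show "((\<lambda>s. of_real (t ^ n) * A f s (t * y)) has_vector_derivative
          of_real (t ^ n) * A1 f s (t * y)) (at s within UNIV)" for s t
        using A(1) f by (auto simp: partials_def intro!: has_vector_derivative_mult_right)
      show "continuous_on (UNIV \<times> cbox 0 1) (\<lambda>(s, t). of_real (t ^ n) * A1 f s (t * y))"
        unfolding case_prod_beta
        by (intro continuous_intros continuous_on_pair_comp[OF c(2)])
    qed (use int in auto)
    thus "((\<lambda>s. integral {0..1} (\<lambda>t. of_real (t ^ n) * A f s (t * y))) has_vector_derivative
        integral {0..1} (\<lambda>t. of_real (t ^ n) * A1 f x (t * y))) (at x)" by simp
    have "((\<lambda>s. integral (cbox 0 1) (\<lambda>t. of_real (t ^ n) * A f x (t * s))) has_vector_derivative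
        integral (cbox 0 1) (\<lambda>t. of_real (t ^ Suc n) * A2 f x (t * y))) (at y within UNIV)"
    proof (rule leibniz_rule_vector_derivative)
      fix s t :: real
      have "((\<lambda>u. A f x u) has_vector_derivative A2 f x (t * s)) (at (t * s))"
        using A(1) f by (auto simp: partials_def)
      from has_vector_derivative_comp_mult[OF this]
      have "((\<lambda>s. A f x (t * s)) has_vector_derivative of_real t * A2 f x (t * s)) (at s)" .
      hence "((\<lambda>s. of_real (t ^ n) * A f x (t * s)) has_vector_derivative
          of_real (t ^ n) * (of_real t * A2 f x (t * s))) (at s)"
        by (rule has_vector_derivative_mult_right)
      thus "((\<lambda>s. of_real (t ^ n) * A f x (t * s)) has_vector_derivative
          of_real (t ^ Suc n) * A2 f x (t * s)) (at s within UNIV)" by (simp add: mult_ac)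
      show "continuous_on (UNIV \<times> cbox 0 1) (\<lambda>(s, t). of_real (t ^ Suc n) * A2 f x (t * s))"
        unfolding case_prod_beta
        by (intro continuous_intros continuous_on_pair_comp[OF c(3)])
    qed (use int in auto)
    thus "((\<lambda>s. integral {0..1} (\<lambda>t. of_real (t ^ n) * A f x (t * s))) has_vector_derivative
        integral {0..1} (\<lambda>t. of_real (t ^ Suc n) * A2 f x (t * y))) (at y)" by simp
  qed
  moreover have "gauged_continuous {0} (\<lambda>f x y. integral {0..1} (\<lambda>t. of_real (t ^ n) * A f x (t * y)))"
    by (rule smooth_family_base[OF Suc.IH[OF smooth_family_Suc_D[OF Suc.prems]]])
  ultimately show ?case using Suc.IH[OF A(2), of n] Suc.IH[OF A(3), of "Suc n"]
    unfolding smooth_family.simps by blast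
qed

lemma partials_unique:
  assumes "partials A A1 A2" "partials A B1 B2" "f \<in> schwartz_space"
  shows "A1 f x y = B1 f x y" "A2 f x y = B2 f x y"
  using assms vector_derivative_unique_at unfolding partials_def by blast+

text \<open>Recovers rapid decay of all derivatives from boundedness of the derivatives of y^p A,
  for every p. Averaging supplies such information only without weights, so decay has to be restored
  afterwards in this way.\<close>

lemma smooth_family_of_powers:
  assumes "\<And>p. smooth_family {0} N (\<lambda>f x y. of_real (y ^ p) * A f x y)"
  shows "smooth_family UNIV N A"
  using assms
proof (induction N arbitrary: A)
  case 0
  have "gauged (\<lambda>f x y. of_real (y ^ p) * A f x y)" for p
    using 0[of p] by (auto simp: gauged_continuous_def)
  with 0[of 0] show ?case by (auto simp: gauged_continuous_def)
next
  case (Suc N)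
  have base: "gauged_continuous UNIV A"
    using Suc.IH[OF Suc.prems[THEN smooth_family_Suc_D]] by (rule smooth_family_base)
  obtain A1 A2 where A: "partials A A1 A2"
    using Suc.prems[of 0] by auto
  have "smooth_family {0} N (\<lambda>f x y. of_real (y ^ p) * A1 f x y) \<and>
      smooth_family {0} N (\<lambda>f x y. of_real (y ^ p) * A2 f x y)" for p
  proof -
    obtain B1 B2 where B: "partials (\<lambda>f x y. of_real (y ^ p) * A f x y) B1 B2"
      "smooth_family {0} N B1" "smooth_family {0} N B2"
      using Suc.prems[of p] by auto
    have "partials (\<lambda>f x y. of_real (y ^ p) * A f x y) (\<lambda>f x y. of_real (y ^ p) * A1 f x y)
        (\<lambda>f x y. of_real (y ^ p) * A2 f x y + of_real (real p * y ^ (p - 1)) * A f x y)"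
      unfolding partials_def
    proof (intro ballI allI conjI)
      fix f x y assume f: "f \<in> schwartz_space"
      have d: "((\<lambda>y. complex_of_real (y ^ p)) has_vector_derivative of_real (real p * y ^ (p - 1))) (at y)"
        using has_vector_derivative_of_real DERIV_pow by fastforce
      show "((\<lambda>s. of_real (y ^ p) * A f s y) has_vector_derivative of_real (y ^ p) * A1 f x y) (at x)"
        using A f by (intro has_vector_derivative_mult_right) (auto simp: partials_def)
      show "((\<lambda>t. of_real (t ^ p) * A f x t) has_vector_derivative
          of_real (y ^ p) * A2 f x y + of_real (real p * y ^ (p - 1)) * A f x y) (at y)"
        by (rule has_vector_derivative_mult[OF d]) (use A f in \<open>auto simp: partials_def\<close>)
    qed
    note eq = partials_unique[OF B(1) this]
    have "smooth_family {0} N (\<lambda>f x y. of_real (y ^ p) * A1 f x y)"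
      by (rule smooth_family_cong[OF eq(1) B(2)])
    \<comment> \<open>The product rule solved for y^p \<open>A2\<close>. For p = 0 the truncated
      exponent \<open>p - 1\<close> is 0, but its coefficient p vanishes.\<close>
    moreover have "smooth_family {0} N
        (\<lambda>f x y. B2 f x y + - of_nat p * (of_real (y ^ (p - 1)) * A f x y))"
      by (intro smooth_family_add B(3) smooth_family_scale smooth_family_Suc_D[OF Suc.prems])
    hence "smooth_family {0} N (\<lambda>f x y. of_real (y ^ p) * A2 f x y)"
      by (rule smooth_family_cong[rotated]) (simp add: eq(2))
    ultimately show ?thesis by blast
  qed
  hence "smooth_family UNIV N A1" "smooth_family UNIV N A2" by (auto intro: Suc.IH)
  with A base show ?case by auto
qed

section \<open>Tame families\<close>

lemma tame_add: "tame A \<Longrightarrow> tame B \<Longrightarrow> tame (\<lambda>f x y. A f x y + B f x y)"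
  by (simp add: tame_def smooth_family_add)

lemma tame_scale: "tame A \<Longrightarrow> tame (\<lambda>f x y. c * A f x y)"
  by (simp add: tame_def smooth_family_scale)

lemma tame_reflect: "tame A \<Longrightarrow> tame (\<lambda>f x y. A f x (- y))"
  by (simp add: tame_def smooth_family_reflect)

lemma tame_multiplier: "tame A \<Longrightarrow> (\<And>N. multiplier N m) \<Longrightarrow> tame (\<lambda>f x y. m x y * A f x y)"
  by (simp add: tame_def smooth_family_multiplier)

lemma tame_cong: "tame A \<Longrightarrow> (\<And>f x y. f \<in> schwartz_space \<Longrightarrow> A f x y = B f x y) \<Longrightarrow> tame B"
  using smooth_family_cong[of A B] unfolding tame_def by blast

text \<open>The definition provides a pair of partial derivatives for each N separately; uniqueness
  of derivatives makes one pair serve all N.\<close>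

lemma tame_partials:
  assumes "tame A"
  shows "\<exists>A1 A2. partials A A1 A2 \<and> tame A1 \<and> tame A2"
proof -
  have *: "\<exists>A1 A2. partials A A1 A2 \<and> smooth_family UNIV N A1 \<and> smooth_family UNIV N A2" for N
    using assms[unfolded tame_def, rule_format, of "Suc N"] by auto
  then obtain A1 A2 where A: "partials A A1 A2" by blast
  have "smooth_family UNIV N A1 \<and> smooth_family UNIV N A2" for N
  proof -
    obtain B1 B2 where B: "partials A B1 B2" "smooth_family UNIV N B1" "smooth_family UNIV N B2"
      using *[of N] by blast
    show ?thesis
      using smooth_family_cong[OF partials_unique(1)[OF B(1) A] B(2)]
        smooth_family_cong[OF partials_unique(2)[OF B(1) A] B(3)] by blast
  qed
  with A show ?thesis unfolding tame_def by blast
qed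

lemma tame_base: "tame A \<Longrightarrow> gauged_continuous UNIV A"
  using smooth_family_base unfolding tame_def by blast

lemma tame_continuous:
  assumes "tame A" "f \<in> schwartz_space"
  shows "continuous_on UNIV (\<lambda>z. A f (fst z) (snd z))"
  using tame_base[OF assms(1)] assms(2) unfolding gauged_continuous_def by blast

lemma tame_gauged: "tame A \<Longrightarrow> gauged (\<lambda>f x y. of_real (y ^ p) * A f x y)"
  using tame_base unfolding gauged_continuous_def by blast

text \<open>Hadamard's lemma: the quotient by \<open>y\<close> is the mean of the \<open>y\<close>-derivative over \<open>[0, y]\<close>,
  hence smooth; its decay is inherited from the identity \<open>y\<^sup>p\<^sup>+\<^sup>1 B = y\<^sup>p A\<close>.\<close>

lemma tame_divide:
  assumes "tame A" "\<And>f x. f \<in> schwartz_space \<Longrightarrow> A f x 0 = 0"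
  shows "\<exists>B. tame B \<and> (\<forall>f\<in>schwartz_space. \<forall>x y. A f x y = of_real y * B f x y)"
proof -
  obtain A1 A2 where A: "partials A A1 A2" "tame A1" "tame A2"
    using tame_partials[OF assms(1)] by blast
  define B where "B = (\<lambda>f x y. integral {0..1} (\<lambda>t. of_real (t ^ 0) * A2 f x (t * y)))"
  have eq: "A f x y = of_real y * B f x y" if f: "f \<in> schwartz_space" for f x y
  proof -
    have "((\<lambda>t. of_real y * A2 f x (t * y)) has_integral A f x (1 * y) - A f x (0 * y)) {0..1}"
    proof (rule fundamental_theorem_of_calculus)
      fix t :: real
      have "((\<lambda>u. A f x u) has_vector_derivative A2 f x (t * y)) (at (y * t))"
        using A(1) f by (auto simp: partials_def mult.commute)
      from has_vector_derivative_comp_mult[OF this]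
      have "((\<lambda>t. A f x (t * y)) has_vector_derivative of_real y * A2 f x (t * y)) (at t)"
        by (simp add: mult.commute)
      thus "((\<lambda>t. A f x (t * y)) has_vector_derivative of_real y * A2 f x (t * y)) (at t within {0..1})"
        by (rule has_vector_derivative_at_within)
    qed simp
    from integral_unique[OF this] show ?thesis
      using assms(2)[OF f] by (simp add: B_def)
  qed
  have "smooth_family UNIV N B" for N
  proof (rule smooth_family_of_powers)
    fix p
    show "smooth_family {0} N (\<lambda>f x y. of_real (y ^ p) * B f x y)"
    proof (cases p)
      case 0
      have "smooth_family {0} N A2"
        using A(3) smooth_family_mono unfolding tame_def by blast
      from smooth_family_average[OF this, of 0] show ?thesis
        using 0 by (simp add: B_def)
    next
      case (Suc q)
      from tame_multiplier[OF assms(1) multiplier_y_power]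
      have "smooth_family {0} N (\<lambda>f x y. of_real (y ^ q) * A f x y)"
        using smooth_family_mono unfolding tame_def by blast
      thus ?thesis
        by (rule smooth_family_cong[rotated]) (simp add: Suc eq mult_ac)
    qed
  qed
  with eq show ?thesis unfolding tame_def by blast
qed

subsection \<open>Integrals with respect to power weights\<close>

text \<open>The mean value inequality turns the bound w on the derivative into a Lipschitz bound,
  which dominates the difference quotients. The limit is tested along sequences because dominated
  convergence is a statement about sequences.\<close>

lemma has_vector_derivative_integral:
  fixes F :: "real \<Rightarrow> 'a \<Rightarrow> complex"
  assumes d: "\<And>x y. ((\<lambda>x. F x y) has_vector_derivative F' x y) (at x)"
    and int: "\<And>x. integrable M (F x)" and meas: "\<And>x. F' x \<in> borel_measurable M"
    and bound: "\<And>x y. norm (F' x y) \<le> w y" and w: "integrable M w"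
  shows "((\<lambda>x. LINT y|M. F x y) has_vector_derivative (LINT y|M. F' x y)) (at x)"
proof -
  have lip: "norm (F u y - F v y) \<le> w y * norm (u - v)" for u v y
  proof (rule differentiable_bound[of UNIV "\<lambda>u. F u y" "\<lambda>u h. h *\<^sub>R F' u y"])
    fix u
    show "((\<lambda>u. F u y) has_derivative (\<lambda>h. h *\<^sub>R F' u y)) (at u within UNIV)"
      using d[of y u] by (simp add: has_vector_derivative_def)
    have "onorm (\<lambda>h::real. h *\<^sub>R F' u y) = norm (F' u y)"
      using onorm_scaleR_left[OF bounded_linear_ident, of "F' u y"] by (simp add: onorm_id)
    thus "onorm (\<lambda>h. h *\<^sub>R F' u y) \<le> w y" using bound by simp
  qed auto
  have intF': "integrable M (F' x)" for x
    by (rule Bochner_Integration.integrable_bound[OF w meas])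
      (use bound in \<open>auto intro: order_trans[OF _ abs_ge_self]\<close>)
  have "((\<lambda>h. norm ((LINT y|M. F (x + h) y) - (LINT y|M. F x y) - h *\<^sub>R (LINT y|M. F' x y)) / norm h)
      \<longlongrightarrow> 0) (at 0)"
    unfolding tendsto_at_iff_sequentially
  proof (intro allI impI)
    fix X :: "nat \<Rightarrow> real" assume X: "\<forall>i. X i \<in> UNIV - {0}" "X \<longlonglongrightarrow> 0"
    define s where "s = (\<lambda>n y. (F (x + X n) y - F x y - X n *\<^sub>R F' x y) /\<^sub>R X n)"
    have "(\<lambda>n. LINT y|M. s n y) \<longlonglongrightarrow> (LINT y|M. 0)"
    \<comment> \<open>One w comes from the Lipschitz bound on the increment, the other from the
      subtracted linear term.\<close>
    proof (rule integral_dominated_convergence[where w="\<lambda>y. 2 * w y"])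
      show "s n \<in> borel_measurable M" for n
        unfolding s_def using int[THEN borel_measurable_integrable] meas by measurable
      show "AE y in M. (\<lambda>n. s n y) \<longlonglongrightarrow> 0"
      proof (rule AE_I2)
        fix y
        have "((\<lambda>h. norm (F (x + h) y - F x y - h *\<^sub>R F' x y) / norm h) \<longlongrightarrow> 0) (at 0)"
          using d[of y x] unfolding has_vector_derivative_def has_derivative_at by blast
        hence "(\<lambda>n. norm (F (x + X n) y - F x y - X n *\<^sub>R F' x y) / norm (X n)) \<longlonglongrightarrow> 0"
          unfolding tendsto_at_iff_sequentially using X by (auto simp: o_def)
        hence "(\<lambda>n. norm (s n y)) \<longlonglongrightarrow> 0"
          by (simp add: s_def divide_inverse mult.commute)
        thus "(\<lambda>n. s n y) \<longlonglongrightarrow> 0" by (rule tendsto_norm_zero_cancel)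
      qed
      show "AE y in M. norm (s n y) \<le> 2 * w y" for n
      proof (rule AE_I2)
        fix y
        have "norm (F (x + X n) y - F x y - X n *\<^sub>R F' x y) \<le>
            norm (F (x + X n) y - F x y) + norm (X n *\<^sub>R F' x y)"
          by (rule norm_triangle_ineq4)
        also have "\<dots> \<le> w y * \<bar>X n\<bar> + \<bar>X n\<bar> * w y"
          using lip[of "x + X n" y x] mult_left_mono[OF bound[of x y], of "\<bar>X n\<bar>"]
          by (intro add_mono) auto
        finally have le: "norm (F (x + X n) y - F x y - X n *\<^sub>R F' x y) \<le> 2 * w y * \<bar>X n\<bar>"
          by simp
        have "norm (s n y) = norm (F (x + X n) y - F x y - X n *\<^sub>R F' x y) / \<bar>X n\<bar>"
          unfolding s_def norm_scaleR by (simp add: divide_inverse mult.commute)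
        thus "norm (s n y) \<le> 2 * w y" using le X(1) by (simp add: pos_divide_le_eq)
      qed
    qed (use w in auto)
    moreover have "norm (LINT y|M. s n y) =
        norm ((LINT y|M. F (x + X n) y) - (LINT y|M. F x y) - X n *\<^sub>R (LINT y|M. F' x y)) / norm (X n)" for n
    proof -
      have "(LINT y|M. s n y) =
          ((LINT y|M. F (x + X n) y) - (LINT y|M. F x y) - X n *\<^sub>R (LINT y|M. F' x y)) /\<^sub>R X n"
        unfolding s_def using int intF' by simp
      thus ?thesis by (simp add: divide_inverse mult.commute)
    qed
    ultimately show "((\<lambda>h. norm ((LINT y|M. F (x + h) y) - (LINT y|M. F x y) -
        h *\<^sub>R (LINT y|M. F' x y)) / norm h) \<circ> X) \<longlonglongrightarrow> 0"
      using tendsto_norm_zero[of "\<lambda>n. LINT y|M. s n y"] by (simp add: o_def)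
  qed
  thus ?thesis
    unfolding has_vector_derivative_def has_derivative_at
    by (auto intro: bounded_linear_scaleR_left)
qed

lemma integrable_decay: "integrable lborel (\<lambda>y::real. B / (1 + y\<^sup>2))"
  using integrable_inverse_1_plus_square
  by (simp add: set_integrable_def divide_inverse integrable_mult_right)

lemma integrable_weighted:
  fixes F :: "real \<Rightarrow> complex"
  assumes "continuous_on UNIV F" "\<And>y. \<bar>y\<bar> powr a * norm (F y) \<le> B / (1 + y\<^sup>2)"
  shows "integrable lborel (\<lambda>y. (\<bar>y\<bar> powr a) *\<^sub>R F y)"
proof (rule Bochner_Integration.integrable_bound[OF integrable_decay[of B]])
  have [measurable]: "F \<in> borel_measurable borel"
    using assms(1) by (rule borel_measurable_continuous_onI)
  show "(\<lambda>y. (\<bar>y\<bar> powr a) *\<^sub>R F y) \<in> borel_measurable lborel" by measurable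
  show "AE y in lborel. norm ((\<bar>y\<bar> powr a) *\<^sub>R F y) \<le> norm (B / (1 + y\<^sup>2))"
  proof (rule AE_I2)
    fix y
    show "norm ((\<bar>y\<bar> powr a) *\<^sub>R F y) \<le> norm (B / (1 + y\<^sup>2))"
      using assms(2)[of y] abs_ge_self[of "B / (1 + y\<^sup>2)"] by (simp del: abs_divide)
  qed
qed

lemma abs_powr_Suc: "\<bar>y\<bar> powr (a + 1) = \<bar>y\<bar> powr a * \<bar>y\<bar>" for y :: real
  by (simp add: powr_add)

text \<open>On the positive half line the integrand is the derivative of y^(a+1) G(y). The boundary
  term vanishes at 0 because of the power and at infinity by the bound with D.\<close>

lemma integral_euler_operator_halfline:
  fixes G G' :: "real \<Rightarrow> complex"
  assumes a: "0 \<le> a" and d: "\<And>y. (G has_vector_derivative G' y) (at y)"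
    and cont: "continuous_on UNIV (\<lambda>y. of_real (a + 1) * G y + of_real y * G' y)"
    and B: "\<And>y. \<bar>y\<bar> powr a * norm (of_real (a + 1) * G y + of_real y * G' y) \<le> B / (1 + y\<^sup>2)"
    and D: "\<And>y. \<bar>y\<bar> powr (a + 1) * norm (G y) \<le> D / (1 + y\<^sup>2)"
  shows "(LINT y:{0<..}|lborel. (\<bar>y\<bar> powr a) *\<^sub>R (of_real (a + 1) * G y + of_real y * G' y)) = 0"
proof -
  let ?f = "\<lambda>y. (\<bar>y\<bar> powr a) *\<^sub>R (of_real (a + 1) * G y + of_real y * G' y)"
  let ?F = "\<lambda>y. (y powr (a + 1)) *\<^sub>R G y"
  have "(LBINT y=0..\<infinity>. ?f y) = 0 - 0"
  proof (rule interval_integral_FTC_integrable)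
    fix y :: real assume y: "0 < ereal y"
    have "((\<lambda>y. y powr (a + 1)) has_real_derivative (a + 1) * y powr a) (at y)"
      using y by (auto intro!: derivative_eq_intros)
    from has_vector_derivative_scaleR[OF this d]
    have "(?F has_vector_derivative y powr (a + 1) *\<^sub>R G' y + ((a + 1) * y powr a) *\<^sub>R G y) (at y)" .
    also have "y powr (a + 1) *\<^sub>R G' y + ((a + 1) * y powr a) *\<^sub>R G y = ?f y"
      using y by (simp add: powr_add scaleR_conv_of_real algebra_simps)
    finally show "(?F has_vector_derivative ?f y) (at y)" .
    have "isCont (\<lambda>y. of_real (a + 1) * G y + of_real y * G' y) y"
      using cont by (simp add: continuous_on_eq_continuous_at)
    moreover have "isCont (\<lambda>y. \<bar>y\<bar> powr a) y" using y by (intro continuous_intros) auto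
    ultimately show "isCont ?f y" by (intro isCont_scaleR)
  next
    have "integrable lborel ?f" by (rule integrable_weighted[OF cont B])
    thus "set_integrable lborel (einterval 0 \<infinity>) ?f"
      unfolding set_integrable_def by (rule integrable_mult_indicator[rotated]) simp
  next
    \<comment> \<open>Positivity of a + 1 makes the power continuous from the right at 0; this
      includes a = 0, the case \<nu> = -1/2.\<close>
    have "((\<lambda>y::real. y powr (a + 1)) \<longlongrightarrow> 0 powr (a + 1)) (at_right 0)"
      by (intro tendsto_powr2 tendsto_intros) (use a in \<open>auto simp: eventually_at_filter\<close>)
    moreover have "(G \<longlongrightarrow> G 0) (at_right 0)"
      using has_vector_derivative_continuous[OF d[of 0]]
      by (auto simp: continuous_at intro: tendsto_within_subset)
    ultimately have "(?F \<longlongrightarrow> 0 powr (a + 1) *\<^sub>R G 0) (at_right 0)" by (rule tendsto_scaleR)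
    thus "((?F \<circ> real_of_ereal) \<longlongrightarrow> 0) (at_right 0)"
      by (simp add: zero_ereal_def ereal_tendsto_simps)
  next
    have "((\<lambda>y. D / (1 + y\<^sup>2)) \<longlongrightarrow> 0) at_top"
      by (intro tendsto_divide_0[OF tendsto_const] filterlim_at_top_imp_at_infinity
          filterlim_tendsto_add_at_top[OF tendsto_const] filterlim_pow_at_top filterlim_ident) simp
    moreover have "\<forall>\<^sub>F y in at_top. norm (?F y) \<le> D / (1 + y\<^sup>2)"
      using eventually_ge_at_top[of 0]
    proof eventually_elim
      case (elim y)
      thus ?case using D[of y] by simp
    qed
    ultimately have "(?F \<longlongrightarrow> 0) at_top" by (rule Lim_null_comparison[rotated])
    thus "((?F \<circ> real_of_ereal) \<longlongrightarrow> 0) (at_left \<infinity>)" by (simp add: ereal_tendsto_simps)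
  qed simp
  thus ?thesis using interval_integral_to_infinity_eq[of lborel 0 ?f] by (simp add: zero_ereal_def)
qed

lemma integral_reflect_lborel:
  fixes h :: "real \<Rightarrow> complex"
  shows "(LINT y|lborel. h (- y)) = (LINT y|lborel. h y)"
  using lborel_integral_real_affine[of "-1" h 0] by simp

text \<open>The integrand is the derivative of \<open>y \<bar>y\<bar>\<^sup>a G(y)\<close>.\<close>

lemma integral_euler_operator:
  fixes G G' :: "real \<Rightarrow> complex"
  assumes a: "0 \<le> a" and d: "\<And>y. (G has_vector_derivative G' y) (at y)"
    and cont: "continuous_on UNIV (\<lambda>y. of_real (a + 1) * G y + of_real y * G' y)"
    and B: "\<And>y. \<bar>y\<bar> powr a * norm (of_real (a + 1) * G y + of_real y * G' y) \<le> B / (1 + y\<^sup>2)"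
    and D: "\<And>y. \<bar>y\<bar> powr (a + 1) * norm (G y) \<le> D / (1 + y\<^sup>2)"
  shows "(LINT y|lborel. (\<bar>y\<bar> powr a) *\<^sub>R (of_real (a + 1) * G y + of_real y * G' y)) = 0"
proof -
  let ?f = "\<lambda>y. (\<bar>y\<bar> powr a) *\<^sub>R (of_real (a + 1) * G y + of_real y * G' y)"
  have int: "integrable lborel ?f" by (rule integrable_weighted[OF cont B])
  have pos: "(LINT y:{0<..}|lborel. ?f y) = 0"
    by (rule integral_euler_operator_halfline[OF a d cont B D])
  \<comment> \<open>The negative half line is the half-line result for G(-y): its derivative is
    -G'(-y), and y times that is again of Euler form at the point -y.\<close>
  have "(LINT y:{0<..}|lborel. (\<bar>y\<bar> powr a) *\<^sub>R (of_real (a + 1) * G (- y) + of_real y * (- 1 * G' (- y)))) = 0"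
  proof (rule integral_euler_operator_halfline[OF a])
    show "((\<lambda>y. G (- y)) has_vector_derivative - 1 * G' (- y)) (at y)" for y
      using has_vector_derivative_comp_mult[of G "G' (- y)" "-1" y] d by simp
    have "continuous_on UNIV (\<lambda>y. of_real (a + 1) * G (- y) + of_real (- y) * G' (- y))"
      by (rule continuous_on_compose2[OF cont]) (auto intro!: continuous_intros)
    thus "continuous_on UNIV (\<lambda>y. of_real (a + 1) * G (- y) + of_real y * (- 1 * G' (- y)))"
      by simp
    show "\<bar>y\<bar> powr a * norm (of_real (a + 1) * G (- y) + of_real y * (- 1 * G' (- y))) \<le> B / (1 + y\<^sup>2)" for y
      using B[of "- y"] by simp
    show "\<bar>y\<bar> powr (a + 1) * norm (G (- y)) \<le> D / (1 + y\<^sup>2)" for y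
      using D[of "- y"] by simp
  qed
  hence neg: "(LINT y|lborel. indicator {..<0} y *\<^sub>R ?f y) = 0"
    using integral_reflect_lborel[of "\<lambda>y. indicator {..<0} y *\<^sub>R ?f y"]
    by (simp add: set_lebesgue_integral_def indicator_def cong: if_cong)
  have "(LINT y|lborel. ?f y) = (LINT y|lborel. indicator {0<..} y *\<^sub>R ?f y + indicator {..<0} y *\<^sub>R ?f y)"
  proof (rule integral_cong_AE)
    have "AE y in lborel. y \<noteq> (0::real)" by (rule AE_lborel_singleton)
    thus "AE y in lborel. ?f y = indicator {0<..} y *\<^sub>R ?f y + indicator {..<0} y *\<^sub>R ?f y"
      by eventually_elim (auto simp: indicator_def)
    define K where "K = (\<lambda>y. of_real (a + 1) * G y + of_real y * G' y)"
    have [measurable]: "K \<in> borel_measurable borel"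
      using cont unfolding K_def by (rule borel_measurable_continuous_onI)
    have "(\<lambda>y. (\<bar>y\<bar> powr a) *\<^sub>R K y) \<in> borel_measurable lborel"
      "(\<lambda>y. indicator {0<..} y *\<^sub>R (\<bar>y\<bar> powr a) *\<^sub>R K y +
        indicator {..<0} y *\<^sub>R (\<bar>y\<bar> powr a) *\<^sub>R K y) \<in> borel_measurable lborel"
      by measurable
    thus "?f \<in> borel_measurable lborel"
      "(\<lambda>y. indicator {0<..} y *\<^sub>R ?f y + indicator {..<0} y *\<^sub>R ?f y) \<in> borel_measurable lborel"
      unfolding K_def .
  qed
  also have "\<dots> = (LINT y|lborel. indicator {0<..} y *\<^sub>R ?f y) + (LINT y|lborel. indicator {..<0} y *\<^sub>R ?f y)"
    by (intro Bochner_Integration.integral_add integrable_mult_indicator int) auto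
  finally show ?thesis using pos neg by (simp add: set_lebesgue_integral_def)
qed

text \<open>The two powers by which q exceeds a pay for the integrable factor 1 / (1 + y^2) when |y|
  > 1; the constant 1 covers |y| <= 1.\<close>

lemma abs_powr_le_decay:
  fixes y :: real
  assumes "0 \<le> a" "a + 2 \<le> real q"
  shows "\<bar>y\<bar> powr a \<le> 2 * (1 + \<bar>y\<bar> ^ q) / (1 + y\<^sup>2)"
proof (cases "\<bar>y\<bar> \<le> 1")
  case True
  have "\<bar>y\<bar> powr a * (1 + y\<^sup>2) \<le> 1 * 2"
    using True assms by (intro mult_mono powr_le1) (auto simp: abs_square_le_1)
  also have "\<dots> \<le> 2 * (1 + \<bar>y\<bar> ^ q)" by simp
  finally show ?thesis by (simp add: pos_le_divide_eq add_pos_nonneg)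
next
  case False
  hence "1 \<le> \<bar>y\<bar> ^ 2" by (intro one_le_power) auto
  hence "\<bar>y\<bar> powr a * (1 + y\<^sup>2) \<le> \<bar>y\<bar> powr a * (2 * \<bar>y\<bar> ^ 2)"
    by (intro mult_left_mono) auto
  also have "\<dots> = 2 * \<bar>y\<bar> powr (a + 2)" using False by (simp add: powr_add powr_numeral)
  also have "\<bar>y\<bar> powr (a + 2) \<le> \<bar>y\<bar> powr real q" using False assms by (intro powr_mono) auto
  also have "\<dots> = \<bar>y\<bar> ^ q" using False by (intro powr_realpow) auto
  also have "2 * \<bar>y\<bar> ^ q \<le> 2 * (1 + \<bar>y\<bar> ^ q)" by simp
  finally show ?thesis by (simp add: pos_le_divide_eq add_pos_nonneg)
qed

text \<open>The moments of order 0 and q dominate the power weight, with an integrable majorant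
  independent of x and a constant that is still a gauge.\<close>

lemma tame_weighted:
  assumes "tame A" "0 \<le> a"
  shows "\<exists>g. gauge_fun g \<and>
    (\<forall>f\<in>schwartz_space. \<forall>x y. \<bar>y\<bar> powr a * norm (A f x y) \<le> g f / (1 + y\<^sup>2))"
proof -
  define q where "q = nat \<lceil>a + 2\<rceil>"
  have q: "a + 2 \<le> real q" using assms(2) unfolding q_def by linarith
  obtain g where g: "gauge_fun g"
    "\<forall>f\<in>schwartz_space. \<forall>x y. norm (of_real (y ^ 0) * A f x y) \<le> g f"
    using tame_gauged[OF assms(1), of 0] unfolding gauged_def by blast
  obtain h where h: "gauge_fun h"
    "\<forall>f\<in>schwartz_space. \<forall>x y. norm (of_real (y ^ q) * A f x y) \<le> h f"
    using tame_gauged[OF assms(1), of q] unfolding gauged_def by blast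
  have "gauge_fun (\<lambda>f. 2 * (g f + h f))"
    by (rule gauge_fun_le[OF gauge_fun_add[OF g(1) h(1)], of 2]) auto
  moreover have "\<bar>y\<bar> powr a * norm (A f x y) \<le> 2 * (g f + h f) / (1 + y\<^sup>2)"
    if f: "f \<in> schwartz_space" for f x y
  proof -
    have p: "0 < 1 + y\<^sup>2" by (simp add: add_pos_nonneg)
    have "\<bar>y\<bar> powr a * norm (A f x y) \<le> 2 * (1 + \<bar>y\<bar> ^ q) / (1 + y\<^sup>2) * norm (A f x y)"
      by (intro mult_right_mono abs_powr_le_decay assms q) auto
    also have "\<dots> = 2 * (norm (A f x y) + norm (of_real (y ^ q) * A f x y)) / (1 + y\<^sup>2)"
      by (simp add: norm_mult norm_power algebra_simps)
    also have "\<dots> \<le> 2 * (g f + h f) / (1 + y\<^sup>2)"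
      using g(2) h(2) f p by (intro divide_right_mono mult_left_mono add_mono) auto
    finally show ?thesis .
  qed
  ultimately show ?thesis by (intro exI[of _ "\<lambda>f. 2 * (g f + h f)"]) auto
qed

lemma tame_section_continuous:
  assumes "tame A" "f \<in> schwartz_space"
  shows "continuous_on UNIV (A f x)"
  using continuous_on_pair_comp[OF tame_continuous[OF assms], of UNIV "\<lambda>_. x" "\<lambda>y. y"]
  by (simp add: continuous_on_const continuous_on_id)

lemma integrable_kernel:
  assumes "tame A" "f \<in> schwartz_space" "0 \<le> a" "continuous_on UNIV K" "\<And>y. norm (K y) \<le> 1"
  shows "integrable lborel (\<lambda>y. (\<bar>y\<bar> powr a) *\<^sub>R (K y * A f x y))"
proof -
  obtain g where g: "\<forall>f\<in>schwartz_space. \<forall>x y. \<bar>y\<bar> powr a * norm (A f x y) \<le> g f / (1 + y\<^sup>2)"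
    using tame_weighted[OF assms(1,3)] by blast
  show ?thesis
  proof (rule integrable_weighted)
    show "continuous_on UNIV (\<lambda>y. K y * A f x y)"
      by (intro continuous_intros assms tame_section_continuous)
    fix y
    have "\<bar>y\<bar> powr a * norm (K y * A f x y) \<le> \<bar>y\<bar> powr a * (1 * norm (A f x y))"
      unfolding norm_mult by (intro mult_left_mono mult_right_mono assms) auto
    also have "\<dots> \<le> g f / (1 + y\<^sup>2)" using g assms(2) by simp
    finally show "\<bar>y\<bar> powr a * norm (K y * A f x y) \<le> g f / (1 + y\<^sup>2)" .
  qed
qed

subsection \<open>Hankel transforms of even families\<close>

definition even_family :: "family \<Rightarrow> bool" where
  "even_family A \<longleftrightarrow> (\<forall>f\<in>schwartz_space. \<forall>x y. A f x (- y) = A f x y)"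

text \<open>The same x enters the Bessel kernel and the family: the symbol is evaluated at the
  output point, so this is a diagonal value of a transform with parameter.\<close>

definition hankel :: "real \<Rightarrow> real \<Rightarrow> family \<Rightarrow> (real \<Rightarrow> complex) \<Rightarrow> real \<Rightarrow> complex" where
  "hankel c \<nu> A f x =
     (LINT y|lborel. (\<bar>y\<bar> powr (2 * \<nu> + 1)) *\<^sub>R (of_real (normalized_bessel \<nu> (c * x * y)) * A f x y))"

lemma norm_bessel_le: "\<nu> \<ge> - 1 / 2 \<Longrightarrow> norm (complex_of_real (normalized_bessel \<nu> z)) \<le> 1"
  using normalized_bessel_bound(1) by simp

lemma continuous_bessel_section:
  "\<nu> \<ge> - 1 / 2 \<Longrightarrow> continuous_on UNIV (\<lambda>y. complex_of_real (normalized_bessel \<nu> (c * x * y)))"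
  by (intro continuous_intros) auto

lemma hankel_integrable:
  assumes "tame A" "f \<in> schwartz_space" "\<nu> \<ge> - 1 / 2"
  shows "integrable lborel
    (\<lambda>y. (\<bar>y\<bar> powr (2 * \<nu> + 1)) *\<^sub>R (of_real (normalized_bessel \<nu> (c * x * y)) * A f x' y))"
  using assms by (intro integrable_kernel norm_bessel_le continuous_bessel_section) auto

lemma integral_add_mult:
  fixes f g :: "'a \<Rightarrow> complex"
  assumes "integrable M f" "integrable M g"
  shows "(LINT y|M. f y + C * g y) = (LINT y|M. f y) + C * (LINT y|M. g y)"
  using assms by simp

lemma gauged_hankel:
  assumes "tame A" "\<nu> \<ge> - 1 / 2"
  shows "gauged (\<lambda>f x y. hankel c \<nu> A f y)"
proof -
  obtain g where g: "gauge_fun g"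
    "\<forall>f\<in>schwartz_space. \<forall>x y. \<bar>y\<bar> powr (2 * \<nu> + 1) * norm (A f x y) \<le> g f / (1 + y\<^sup>2)"
    using tame_weighted[OF assms(1), of "2 * \<nu> + 1"] assms(2) by auto
  define K where "K = (LINT y|lborel. 1 / (1 + y\<^sup>2) :: real)"
  have K: "0 \<le> K" unfolding K_def by (intro integral_nonneg_AE AE_I2) (simp add: add_nonneg_nonneg)
  have "norm (hankel c \<nu> A f x) \<le> K * g f" if f: "f \<in> schwartz_space" for f x
  proof -
    have "norm (hankel c \<nu> A f x) \<le> (LINT y|lborel. norm ((\<bar>y\<bar> powr (2 * \<nu> + 1)) *\<^sub>R
        (of_real (normalized_bessel \<nu> (c * x * y)) * A f x y)))"
      unfolding hankel_def by (rule integral_norm_bound)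
    also have "\<dots> \<le> (LINT y|lborel. g f / (1 + y\<^sup>2))"
    proof (rule integral_mono)
      fix y :: real
      have "norm ((\<bar>y\<bar> powr (2 * \<nu> + 1)) *\<^sub>R (of_real (normalized_bessel \<nu> (c * x * y)) * A f x y)) \<le>
          \<bar>y\<bar> powr (2 * \<nu> + 1) * (1 * norm (A f x y))"
        unfolding norm_scaleR norm_mult
        unfolding real_norm_def abs_abs
        by (simp only: abs_of_nonneg[OF powr_ge_zero])
          (intro mult_left_mono mult_right_mono norm_bessel_le assms, auto)
      also have "\<dots> \<le> g f / (1 + y\<^sup>2)" using g(2) f by simp
      finally show "norm ((\<bar>y\<bar> powr (2 * \<nu> + 1)) *\<^sub>R
          (of_real (normalized_bessel \<nu> (c * x * y)) * A f x y)) \<le> g f / (1 + y\<^sup>2)" .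
    qed (intro integrable_norm hankel_integrable assms f integrable_decay)+
    also have "\<dots> = K * g f"
      unfolding K_def using integrable_decay[of 1]
      by (subst mult.commute, subst integral_mult_right_zero[symmetric]) simp
    finally show ?thesis .
  qed
  moreover have "gauge_fun (\<lambda>f. K * g f)" by (rule gauge_fun_le[OF g(1) K]) simp
  ultimately show ?thesis unfolding gauged_def by blast
qed

lemma bessel_section_deriv:
  assumes "\<nu> \<ge> - 1 / 2"
  shows "((\<lambda>x. complex_of_real (normalized_bessel \<nu> (r * x))) has_vector_derivative
    of_real (r * (- (r * x) * normalized_bessel (\<nu> + 1) (r * x) / (2 * (\<nu> + 1))))) (at x)"
proof -
  have "((\<lambda>x. r * x) has_real_derivative r) (at x)" by (auto intro!: derivative_eq_intros)
  from DERIV_chain2[OF normalized_bessel_deriv[OF assms] this]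
  have "((\<lambda>x. normalized_bessel \<nu> (r * x)) has_real_derivative
      r * (- (r * x) * normalized_bessel (\<nu> + 1) (r * x) / (2 * (\<nu> + 1)))) (at x)"
    by (simp only: mult.commute)
  thus ?thesis by (rule has_vector_derivative_of_real)
qed

text \<open>Differentiating j_\<nu>(c x y) in x yields -c^2 x y^2 j_(\<nu>+1)(c x y) / (2 (\<nu> +
  1)), and y^2 turns the weight of order \<nu> into that of order \<nu> + 1.\<close>

lemma hankel_deriv:
  assumes A: "tame A" "tame A1" "partials A A1 A2" and f: "f \<in> schwartz_space" and \<nu>: "\<nu> \<ge> - 1 / 2"
  shows "((\<lambda>x. hankel c \<nu> A f x) has_vector_derivative
     hankel c \<nu> A1 f x + of_real (- c\<^sup>2 * x / (2 * (\<nu> + 1))) * hankel c (\<nu> + 1) A f x) (at x)"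
proof -
  let ?w = "\<lambda>y::real. \<bar>y\<bar> powr (2 * \<nu> + 1)"
  let ?j = "\<lambda>\<nu> x y. complex_of_real (normalized_bessel \<nu> (c * x * y))"
  define d where "d x y = complex_of_real
    ((c * y) * (- (c * x * y) * normalized_bessel (\<nu> + 1) (c * x * y) / (2 * (\<nu> + 1))))" for x y
  define F' where "F' = (\<lambda>x y. ?w y *\<^sub>R (?j \<nu> x y * A1 f x y + d x y * A f x y))"
  have nd: "norm (d x y) \<le> \<bar>c\<bar> * \<bar>y\<bar>" for x y
  proof -
    have "norm (d x y) = \<bar>c\<bar> * \<bar>y\<bar> * \<bar>(c * x * y) * normalized_bessel (\<nu> + 1) (c * x * y) / (2 * (\<nu> + 1))\<bar>"
      unfolding d_def norm_of_real by (simp add: abs_mult)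
    also have "\<dots> \<le> \<bar>c\<bar> * \<bar>y\<bar> * 1"
      by (intro mult_left_mono normalized_bessel_bound \<nu>) auto
    finally show ?thesis by simp
  qed
  have cd: "continuous_on UNIV (d x)" for x
    unfolding d_def using \<nu> by (intro continuous_intros) auto
  obtain g where g: "\<forall>f\<in>schwartz_space. \<forall>x y. \<bar>y\<bar> powr (2 * \<nu> + 1) * norm (A1 f x y) \<le> g f / (1 + y\<^sup>2)"
    using tame_weighted[OF A(2), of "2 * \<nu> + 1"] \<nu> by auto
  \<comment> \<open>The x-derivative of the kernel is c y j_\<nu>'(c x y), at most |c| |y| in
    modulus; the additional power in the weight absorbs this |y|.\<close>
  obtain h where h: "\<forall>f\<in>schwartz_space. \<forall>x y. \<bar>y\<bar> powr (2 * \<nu> + 1 + 1) * norm (A f x y) \<le> h f / (1 + y\<^sup>2)"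
    using tame_weighted[OF A(1), of "2 * \<nu> + 1 + 1"] \<nu> by auto
  have bound: "norm (F' x y) \<le> (g f + \<bar>c\<bar> * h f) / (1 + y\<^sup>2)" for x y
  proof -
    have "norm (F' x y) = ?w y * norm (?j \<nu> x y * A1 f x y + d x y * A f x y)"
      by (simp add: F'_def)
    also have "\<dots> \<le> ?w y * (norm (?j \<nu> x y * A1 f x y) + norm (d x y * A f x y))"
      by (intro mult_left_mono norm_triangle_ineq) auto
    also have "\<dots> \<le> ?w y * (1 * norm (A1 f x y) + (\<bar>c\<bar> * \<bar>y\<bar>) * norm (A f x y))"
      unfolding norm_mult
      by (intro mult_left_mono add_mono mult_right_mono norm_bessel_le \<nu> nd) auto
    also have "\<dots> = ?w y * norm (A1 f x y) + \<bar>c\<bar> * (\<bar>y\<bar> powr (2 * \<nu> + 1 + 1) * norm (A f x y))"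
      unfolding abs_powr_Suc by (simp add: algebra_simps)
    also have "\<dots> \<le> g f / (1 + y\<^sup>2) + \<bar>c\<bar> * (h f / (1 + y\<^sup>2))"
      using g h f by (intro add_mono mult_left_mono) auto
    finally show ?thesis by (simp add: add_divide_distrib)
  qed
  have "((\<lambda>x. hankel c \<nu> A f x) has_vector_derivative (LINT y|lborel. F' x y)) (at x)"
    unfolding hankel_def
  proof (rule has_vector_derivative_integral[where w="\<lambda>y. (g f + \<bar>c\<bar> * h f) / (1 + y\<^sup>2)"])
    fix x y
    have "((\<lambda>x. ?j \<nu> x y) has_vector_derivative d x y) (at x)"
      unfolding d_def using bessel_section_deriv[OF \<nu>, of "c * y" x] by (simp add: mult_ac)
    moreover have "((\<lambda>x. A f x y) has_vector_derivative A1 f x y) (at x)"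
      using A(3) f by (auto simp: partials_def)
    ultimately have "((\<lambda>x. ?j \<nu> x y * A f x y) has_vector_derivative
        ?j \<nu> x y * A1 f x y + d x y * A f x y) (at x)"
      by (rule has_vector_derivative_mult)
    thus "((\<lambda>x. ?w y *\<^sub>R (?j \<nu> x y * A f x y)) has_vector_derivative F' x y) (at x)"
      unfolding F'_def by (rule bounded_linear.has_vector_derivative[OF bounded_linear_scaleR_right])
  next
    fix x
    have [measurable]: "(\<lambda>y. ?j \<nu> x y * A1 f x y + d x y * A f x y) \<in> borel_measurable borel"
      by (intro borel_measurable_continuous_onI continuous_intros cd continuous_bessel_section \<nu>
          tame_section_continuous A f)
    show "F' x \<in> borel_measurable lborel" unfolding F'_def by measurable
  qed (intro hankel_integrable integrable_decay bound A f \<nu>)+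
  also have "(LINT y|lborel. F' x y) =
      (LINT y|lborel. ?w y *\<^sub>R (?j \<nu> x y * A1 f x y) +
        of_real (- c\<^sup>2 * x / (2 * (\<nu> + 1))) * (\<bar>y\<bar> powr (2 * (\<nu> + 1) + 1) *\<^sub>R (?j (\<nu> + 1) x y * A f x y)))"
  proof (rule Bochner_Integration.integral_cong[OF refl])
    fix y :: real
    have w: "\<bar>y\<bar> powr (2 * (\<nu> + 1) + 1) = ?w y * y\<^sup>2"
      using abs_powr_Suc[of y "2 * \<nu> + 1 + 1"] abs_powr_Suc[of y "2 * \<nu> + 1"]
      by (simp add: algebra_simps power2_eq_square abs_mult_self_eq)
    show "F' x y = ?w y *\<^sub>R (?j \<nu> x y * A1 f x y) +
        of_real (- c\<^sup>2 * x / (2 * (\<nu> + 1))) * (\<bar>y\<bar> powr (2 * (\<nu> + 1) + 1) *\<^sub>R (?j (\<nu> + 1) x y * A f x y))"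
      unfolding F'_def d_def w
      by (simp add: scaleR_conv_of_real algebra_simps power2_eq_square)
  qed
  also have "\<dots> = hankel c \<nu> A1 f x + of_real (- c\<^sup>2 * x / (2 * (\<nu> + 1))) * hankel c (\<nu> + 1) A f x"
  proof -
    have "integrable lborel (\<lambda>y. \<bar>y\<bar> powr (2 * (\<nu> + 1) + 1) *\<^sub>R (?j (\<nu> + 1) x y * A f x y))"
      by (rule hankel_integrable) (use A f \<nu> in auto)
    thus ?thesis
      unfolding hankel_def by (rule integral_add_mult[OF hankel_integrable[OF A(2) f \<nu>]])
  qed
  finally show ?thesis .
qed

text \<open>Both parities follow from uniqueness of derivatives, comparing A with its reflection in
  y.\<close>

lemma even_family_partials:
  assumes "even_family A" "partials A A1 A2"
  shows "even_family A1" and "f \<in> schwartz_space \<Longrightarrow> A2 f x (- y) = - A2 f x y"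
proof -
  have *: "A1 f x (- y) = A1 f x y \<and> A2 f x (- y) = - A2 f x y" if f: "f \<in> schwartz_space" for f x y
  proof
    have e: "A f x (- y) = A f x y" for x y using assms(1) f by (auto simp: even_family_def)
    have d: "((\<lambda>s. A f s y) has_vector_derivative A1 f x y) (at x)"
      "((\<lambda>t. A f x t) has_vector_derivative A2 f x y) (at y)" for x y
      using assms(2) f by (auto simp: partials_def)
    show "A1 f x (- y) = A1 f x y"
      by (rule vector_derivative_unique_at[OF d(1)[of "- y" x, unfolded e] d(1)])
    have "((\<lambda>t. A f x t) has_vector_derivative - 1 * A2 f x (- y)) (at y)"
      using has_vector_derivative_comp_mult[of "A f x" _ "-1" y] d(2)[of x "- y"] e by simp
    from vector_derivative_unique_at[OF this d(2)] show "A2 f x (- y) = - A2 f x y"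
      by (metis minus_minus mult_minus1)
  qed
  show "even_family A1" using * by (auto simp: even_family_def)
  show "f \<in> schwartz_space \<Longrightarrow> A2 f x (- y) = - A2 f x y" using * by blast
qed

text \<open>The Bessel operator \<open>L = \<partial>\<^sup>2 + (2 \<nu> + 1) y\<^sup>-\<^sup>1 \<partial>\<close>, written as \<open>(2 \<nu> + 2) D + y \<partial> D\<close>
  with \<open>D = y\<^sup>-\<^sup>1 \<partial>\<close>, is symmetric for the weight and has the Bessel function as eigenfunction.\<close>

lemma hankel_eigen:
  assumes A: "tame A" "even_family A" and \<nu>: "\<nu> \<ge> - 1 / 2"
  shows "\<exists>L. tame L \<and> even_family L \<and>
    (\<forall>f\<in>schwartz_space. \<forall>x. of_real ((c * x)\<^sup>2) * hankel c \<nu> A f x = - hankel c \<nu> L f x)"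
proof -
  obtain A1 A2 where p: "partials A A1 A2" and A2: "tame A2"
    using tame_partials[OF A(1)] by blast
  have odd: "A2 f x (- y) = - A2 f x y" if "f \<in> schwartz_space" for f x y
    by (rule even_family_partials(2)[OF A(2) p that])
  have "A2 f x 0 = 0" if "f \<in> schwartz_space" for f x
    using odd[OF that, of x 0] by simp
  then obtain D where D: "tame D" and A2D: "\<And>f x y. f \<in> schwartz_space \<Longrightarrow> A2 f x y = of_real y * D f x y"
    using tame_divide[OF A2] by metis
  have evD: "even_family D"
    unfolding even_family_def
  proof (intro ballI allI)
    fix f x y assume f: "f \<in> schwartz_space"
    show "D f x (- y) = D f x y"
    proof (cases "y = 0")
      case False
      have "of_real y * D f x (- y) = of_real y * D f x y"
        using odd[OF f, of x y] A2D[OF f, of x y] A2D[OF f, of x "- y"] by simp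
      thus ?thesis using False by simp
    qed simp
  qed
  obtain D1 D2 where pD: "partials D D1 D2" and D2: "tame D2"
    using tame_partials[OF D] by blast
  define L where "L = (\<lambda>f x y. of_real (2 * \<nu> + 2) * D f x y + of_real y * D2 f x y)"
  have L: "tame L" unfolding L_def
    by (intro tame_add tame_scale D tame_multiplier[OF D2] multiplier_y)
  have evL: "even_family L"
    using evD even_family_partials(2)[OF evD pD] by (auto simp: even_family_def L_def)
  have "of_real ((c * x)\<^sup>2) * hankel c \<nu> A f x = - hankel c \<nu> L f x" if f: "f \<in> schwartz_space" for f x
  proof -
    define k where "k = c * x"
    have n0: "\<nu> + 1 \<noteq> 0" using \<nu> by auto
    let ?j = "\<lambda>\<nu> y. complex_of_real (normalized_bessel \<nu> (k * y))"
    let ?w = "\<lambda>y::real. \<bar>y\<bar> powr (2 * \<nu> + 1)"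
    \<comment> \<open>With J(y) = j_\<nu>(k y) and \<open>A2\<close> = y \<open>D\<close>, the
      product y G is the Wronskian J A' - J' A. Thus y |y|^(2 \<nu> + 1) G is the boundary
      expression of the two integrations by parts behind the symmetry of L.\<close>
    define G where "G = (\<lambda>y. ?j \<nu> y * D f x y + of_real (k\<^sup>2 / (2 * (\<nu> + 1))) * (?j (\<nu> + 1) y * A f x y))"
    define G' where "G' = (\<lambda>y. ?j \<nu> y * D2 f x y + of_real (k\<^sup>2 / (2 * (\<nu> + 1)) *
      (k * (- (k * y) * normalized_bessel (\<nu> + 1 + 1) (k * y) / (2 * (\<nu> + 1 + 1))))) * A f x y)"
    \<comment> \<open>Lagrange's identity: the Euler operator applied to G gives J (L A + k^2 A).
      The term k^2 arises from the eigenvalue equation, which enters through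
      \<open>normalized_bessel_deriv_Suc\<close>.\<close>
    have K: "of_real (2 * \<nu> + 1 + 1) * G y + of_real y * G' y =
        ?j \<nu> y * (L f x y + of_real (k\<^sup>2) * A f x y)" for y
    proof -
      obtain e where e: "(normalized_bessel (\<nu> + 1) has_real_derivative e) (at (k * y))"
        "(k * y) * e = 2 * (\<nu> + 1) * (normalized_bessel \<nu> (k * y) - normalized_bessel (\<nu> + 1) (k * y))"
        using normalized_bessel_deriv_Suc[OF \<nu>] by blast
      have e': "- (k * y) * normalized_bessel (\<nu> + 1 + 1) (k * y) / (2 * (\<nu> + 1 + 1)) = e"
        using DERIV_unique[OF normalized_bessel_deriv e(1)] \<nu> by simp
      have "of_real y * (of_real (k\<^sup>2 / (2 * (\<nu> + 1)) * (k * e)) * A f x y) =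
          of_real (k\<^sup>2 / (2 * (\<nu> + 1)) * ((k * y) * e)) * A f x y"
        by simp
      also have "\<dots> = of_real (k\<^sup>2) * ((?j \<nu> y - ?j (\<nu> + 1) y) * A f x y)"
        unfolding e(2) using n0 by simp
      finally have "of_real y * (of_real (k\<^sup>2 / (2 * (\<nu> + 1)) * (k * e)) * A f x y) =
          of_real (k\<^sup>2) * ((?j \<nu> y - ?j (\<nu> + 1) y) * A f x y)" .
      moreover have "of_real (2 * \<nu> + 1 + 1) * (of_real (k\<^sup>2 / (2 * (\<nu> + 1))) * (?j (\<nu> + 1) y * A f x y)) =
          of_real (k\<^sup>2) * (?j (\<nu> + 1) y * A f x y)"
      proof -
        have "(2 * \<nu> + 1 + 1) * (k\<^sup>2 / (2 * (\<nu> + 1))) = k\<^sup>2" using n0 by (simp add: field_simps)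
        thus ?thesis by (metis mult.assoc of_real_mult)
      qed
      ultimately show ?thesis
        unfolding G_def G'_def L_def e' by (simp add: algebra_simps)
    qed
    have dG: "(G has_vector_derivative G' y) (at y)" for y
    proof -
      have j: "(?j \<nu> has_vector_derivative
          of_real (k * (- (k * y) * normalized_bessel (\<nu> + 1) (k * y) / (2 * (\<nu> + 1))))) (at y)"
        "(?j (\<nu> + 1) has_vector_derivative
          of_real (k * (- (k * y) * normalized_bessel (\<nu> + 1 + 1) (k * y) / (2 * (\<nu> + 1 + 1))))) (at y)"
        by (rule bessel_section_deriv, use \<nu> in simp)+
      have dd: "(D f x has_vector_derivative D2 f x y) (at y)"
        "(A f x has_vector_derivative A2 f x y) (at y)"
        using p pD f by (auto simp: partials_def)
      have "(G has_vector_derivative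
          (?j \<nu> y * D2 f x y + of_real (k * (- (k * y) * normalized_bessel (\<nu> + 1) (k * y) / (2 * (\<nu> + 1)))) * D f x y) +
          of_real (k\<^sup>2 / (2 * (\<nu> + 1))) * (?j (\<nu> + 1) y * A2 f x y +
            of_real (k * (- (k * y) * normalized_bessel (\<nu> + 1 + 1) (k * y) / (2 * (\<nu> + 1 + 1)))) * A f x y)) (at y)"
        unfolding G_def
        by (intro has_vector_derivative_add has_vector_derivative_mult_right has_vector_derivative_mult j dd)
      \<comment> \<open>The first-order cross terms of the Wronskian cancel once \<open>A2\<close>
        is written as y \<open>D\<close>.\<close>
      moreover have "of_real (k * (- (k * y) * normalized_bessel (\<nu> + 1) (k * y) / (2 * (\<nu> + 1)))) * D f x y +
          of_real (k\<^sup>2 / (2 * (\<nu> + 1))) * (?j (\<nu> + 1) y * A2 f x y) = 0"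
        unfolding A2D[OF f] by (simp add: power2_eq_square)
      moreover have "(P + Q) + R * (S + T) = P + R * T" if "Q + R * S = 0" for P Q R S T :: complex
      proof -
        have "(P + Q) + R * (S + T) = P + R * T + (Q + R * S)" by (simp add: algebra_simps)
        thus ?thesis using that by simp
      qed
      ultimately show ?thesis
        unfolding G'_def by (simp only: of_real_mult mult.assoc)
    qed
    have tK: "tame (\<lambda>f u y. L f u y + of_real (k\<^sup>2) * A f u y)"
      by (intro tame_add tame_scale L A)
    obtain g where g: "\<forall>f\<in>schwartz_space. \<forall>u y. \<bar>y\<bar> powr (2 * \<nu> + 1) *
        norm (L f u y + of_real (k\<^sup>2) * A f u y) \<le> g f / (1 + y\<^sup>2)"
      using tame_weighted[OF tK, of "2 * \<nu> + 1"] \<nu> by auto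
    obtain h where h: "\<forall>f\<in>schwartz_space. \<forall>x y. \<bar>y\<bar> powr (2 * \<nu> + 1 + 1) * norm (D f x y) \<le> h f / (1 + y\<^sup>2)"
      using tame_weighted[OF D, of "2 * \<nu> + 1 + 1"] \<nu> by auto
    obtain i where i: "\<forall>f\<in>schwartz_space. \<forall>x y. \<bar>y\<bar> powr (2 * \<nu> + 1 + 1) * norm (A f x y) \<le> i f / (1 + y\<^sup>2)"
      using tame_weighted[OF A(1), of "2 * \<nu> + 1 + 1"] \<nu> by auto
    have jle: "norm (?j \<nu> y * z) \<le> norm z" if "\<nu> \<ge> - 1 / 2" for \<nu> y z
      using mult_right_mono[OF norm_bessel_le[OF that], of "norm z" "k * y"] by (simp add: norm_mult)
    have "(LINT y|lborel. ?w y *\<^sub>R (of_real (2 * \<nu> + 1 + 1) * G y + of_real y * G' y)) = 0"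
    proof (rule integral_euler_operator[OF _ dG])
      show "continuous_on UNIV (\<lambda>y. of_real (2 * \<nu> + 1 + 1) * G y + of_real y * G' y)"
        unfolding K k_def
        by (intro continuous_intros continuous_bessel_section \<nu> tame_section_continuous L A f)
      show "?w y * norm (of_real (2 * \<nu> + 1 + 1) * G y + of_real y * G' y) \<le> g f / (1 + y\<^sup>2)" for y
      proof -
        have "?w y * norm (of_real (2 * \<nu> + 1 + 1) * G y + of_real y * G' y) \<le>
            ?w y * norm (L f x y + of_real (k\<^sup>2) * A f x y)"
          unfolding K by (intro mult_left_mono jle \<nu>) auto
        also have "\<dots> \<le> g f / (1 + y\<^sup>2)" using g f by blast
        finally show ?thesis .
      qed
      show "\<bar>y\<bar> powr (2 * \<nu> + 1 + 1) * norm (G y) \<le> (h f + \<bar>k\<^sup>2 / (2 * (\<nu> + 1))\<bar> * i f) / (1 + y\<^sup>2)" for y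
      proof -
        have "norm (G y) \<le> norm (D f x y) + \<bar>k\<^sup>2 / (2 * (\<nu> + 1))\<bar> * norm (A f x y)"
        proof -
          have "norm (G y) \<le> norm (?j \<nu> y * D f x y) +
              norm (of_real (k\<^sup>2 / (2 * (\<nu> + 1))) * (?j (\<nu> + 1) y * A f x y))"
            unfolding G_def by (rule norm_triangle_ineq)
          also have "\<dots> \<le> norm (D f x y) + \<bar>k\<^sup>2 / (2 * (\<nu> + 1))\<bar> * norm (A f x y)"
            using \<nu> jle[of "\<nu> + 1" y "A f x y"]
            by (intro add_mono jle) (simp_all only: norm_mult[of "of_real _" "_ * _"] norm_of_real, intro mult_left_mono, auto)
          finally show ?thesis .
        qed
        hence "\<bar>y\<bar> powr (2 * \<nu> + 1 + 1) * norm (G y) \<le>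
            \<bar>y\<bar> powr (2 * \<nu> + 1 + 1) * (norm (D f x y) + \<bar>k\<^sup>2 / (2 * (\<nu> + 1))\<bar> * norm (A f x y))"
          by (rule mult_left_mono) auto
        also have "\<dots> = \<bar>y\<bar> powr (2 * \<nu> + 1 + 1) * norm (D f x y) +
            \<bar>k\<^sup>2 / (2 * (\<nu> + 1))\<bar> * (\<bar>y\<bar> powr (2 * \<nu> + 1 + 1) * norm (A f x y))"
          by (simp only: distrib_left mult.left_commute)
        also have "\<dots> \<le> h f / (1 + y\<^sup>2) + \<bar>k\<^sup>2 / (2 * (\<nu> + 1))\<bar> * (i f / (1 + y\<^sup>2))"
          by (intro add_mono mult_left_mono) (use h i f in auto)
        finally show ?thesis by (simp add: add_divide_distrib)
      qed
    qed (use \<nu> in auto)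
    also have "(LINT y|lborel. ?w y *\<^sub>R (of_real (2 * \<nu> + 1 + 1) * G y + of_real y * G' y)) =
        (LINT y|lborel. ?w y *\<^sub>R (?j \<nu> y * L f x y) + of_real (k\<^sup>2) * (?w y *\<^sub>R (?j \<nu> y * A f x y)))"
      unfolding K by (simp add: scaleR_conv_of_real algebra_simps)
    also have "\<dots> = hankel c \<nu> L f x + of_real (k\<^sup>2) * hankel c \<nu> A f x"
      unfolding hankel_def k_def
      by (rule integral_add_mult[OF hankel_integrable[OF L f \<nu>] hankel_integrable[OF A(1) f \<nu>]])
    finally show ?thesis by (simp add: k_def add_eq_0_iff2)
  qed
  with L evL show ?thesis by blast
qed

text \<open>Each application of L gains a factor y^2 at the cost of 1 / c^2, which settles even
  exponents. An arbitrary p then follows from |y|^p <= 1 + |y|^(2 p), a consequence of (|y|^p - 1)^2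
  >= 0.\<close>

lemma gauged_power_hankel:
  assumes c: "c \<noteq> 0" and "tame A" "even_family A" and \<nu>: "\<nu> \<ge> - 1 / 2"
  shows "gauged (\<lambda>f x y. of_real (y ^ p) * hankel c \<nu> A f y)"
proof -
  have even: "gauged (\<lambda>f x y. of_real (y ^ (2 * p)) * hankel c \<nu> A f y)" for p
    using assms(2,3)
  proof (induction p arbitrary: A)
    case 0
    thus ?case using gauged_hankel[OF _ \<nu>] by simp
  next
    case (Suc p)
    obtain L where L: "tame L" "even_family L"
      "\<forall>f\<in>schwartz_space. \<forall>x. of_real ((c * x)\<^sup>2) * hankel c \<nu> A f x = - hankel c \<nu> L f x"
      using hankel_eigen[OF Suc.prems \<nu>] by metis
    show ?case
    proof (rule gauged_le[OF Suc.IH[OF L(1,2)], of "1 / c\<^sup>2"])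
      fix f x y assume f: "f \<in> schwartz_space"
      have "of_real (y ^ (2 * Suc p)) * hankel c \<nu> A f y =
          of_real (1 / c\<^sup>2) * (of_real (y ^ (2 * p)) * (of_real ((c * y)\<^sup>2) * hankel c \<nu> A f y))"
        using c by (simp add: power_mult_distrib power2_eq_square)
      also have "\<dots> = of_real (1 / c\<^sup>2) * (of_real (y ^ (2 * p)) * - hankel c \<nu> L f y)"
        using L(3) f by simp
      finally have "norm (of_real (y ^ (2 * Suc p)) * hankel c \<nu> A f y) =
          1 / c\<^sup>2 * norm (of_real (y ^ (2 * p)) * hankel c \<nu> L f y)"
        by (simp add: norm_mult norm_power norm_divide)
      thus "\<exists>x' y'. norm (of_real (y ^ (2 * Suc p)) * hankel c \<nu> A f y) \<le>
          1 / c\<^sup>2 * norm (of_real (y' ^ (2 * p)) * hankel c \<nu> L f y')"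
        by (metis order_refl)
    qed simp
  qed
  show ?thesis
  proof (rule gauged_le2[OF even[of 0] even[of p], of 1])
    fix f and x y :: real
    have "\<bar>y\<bar> ^ p \<le> 1 + \<bar>y\<bar> ^ (2 * p)"
    proof -
      have "0 \<le> (\<bar>y\<bar> ^ p - 1)\<^sup>2" by simp
      hence "2 * \<bar>y\<bar> ^ p \<le> 1 + \<bar>y\<bar> ^ (2 * p)" by (simp add: power2_diff power_mult mult.commute[of 2])
      moreover have "0 \<le> \<bar>y\<bar> ^ p" by simp
      ultimately show ?thesis by linarith
    qed
    hence "norm (of_real (y ^ p) * hankel c \<nu> A f y) \<le>
        (1 + \<bar>y\<bar> ^ (2 * p)) * norm (hankel c \<nu> A f y)"
      by (simp add: norm_mult norm_power mult_right_mono)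
    also have "\<dots> = 1 * (norm (of_real (y ^ (2 * 0)) * hankel c \<nu> A f y) +
        norm (of_real (y ^ (2 * p)) * hankel c \<nu> A f y))"
      by (simp add: norm_mult norm_power distrib_right)
    finally show "\<exists>x' y' x'' y''. norm (of_real (y ^ p) * hankel c \<nu> A f y) \<le>
        1 * (norm (of_real (y' ^ (2 * 0)) * hankel c \<nu> A f y') +
        norm (of_real (y'' ^ (2 * p)) * hankel c \<nu> A f y''))" by blast
  qed simp
qed

lemma smooth_family_zero: "smooth_family E N (\<lambda>f x y. 0)"
proof (induction N)
  case 0
  show ?case using gauged_zero by (simp add: gauged_continuous_def)
next
  case (Suc N)
  have "partials (\<lambda>f x y. 0) (\<lambda>f x y. 0) (\<lambda>f x y. 0)" by (simp add: partials_def)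
  with Suc smooth_family_base[OF Suc] show ?case unfolding smooth_family.simps by blast
qed

text \<open>The induction runs over all even tame families and all orders together, because
  differentiation replaces A by its parameter derivative and \<nu> by \<nu> + 1. The factor x it
  creates is an admissible multiplier, the output variable now being the decaying one.\<close>

lemma tame_hankel:
  assumes c: "c \<noteq> 0" and "tame A" "even_family A" "\<nu> \<ge> - 1 / 2"
  shows "tame (\<lambda>f x y. hankel c \<nu> A f y)"
proof -
  have base: "gauged_continuous UNIV (\<lambda>f x y. hankel c \<nu> A f y)"
    if A: "tame A" "even_family A" "\<nu> \<ge> - 1 / 2" for A \<nu>
    unfolding gauged_continuous_def
  proof (intro conjI ballI gauged_power_hankel c A)
    fix f assume f: "f \<in> schwartz_space"
    obtain A1 A2 where "partials A A1 A2" "tame A1" using tame_partials[OF A(1)] by blast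
    hence "continuous_on UNIV (hankel c \<nu> A f)"
      using hankel_deriv[OF A(1) _ _ f A(3)] has_vector_derivative_continuous
      by (blast intro: continuous_at_imp_continuous_on)
    from continuous_on_compose2[OF this continuous_on_snd[OF continuous_on_id]]
    show "continuous_on UNIV (\<lambda>z::real \<times> real. hankel c \<nu> A f (snd z))" by simp
  qed
  have "smooth_family UNIV N (\<lambda>f x y. hankel c \<nu> A f y)" for N
    using assms(2-4)
  proof (induction N arbitrary: A \<nu>)
    case 0
    thus ?case using base by simp
  next
    case (Suc N)
    obtain A1 A2 where A: "partials A A1 A2" "tame A1" using tame_partials[OF Suc.prems(1)] by blast
    have "partials (\<lambda>f x y. hankel c \<nu> A f y) (\<lambda>f x y. 0)
        (\<lambda>f x y. hankel c \<nu> A1 f y + of_real (- c\<^sup>2 / (2 * (\<nu> + 1))) * (of_real y * hankel c (\<nu> + 1) A f y))"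
      using hankel_deriv[OF Suc.prems(1) A(2,1) _ Suc.prems(3)]
      by (auto simp: partials_def mult_ac)
    moreover have "smooth_family UNIV N
        (\<lambda>f x y. hankel c \<nu> A1 f y + of_real (- c\<^sup>2 / (2 * (\<nu> + 1))) * (of_real y * hankel c (\<nu> + 1) A f y))"
      by (intro smooth_family_add smooth_family_scale smooth_family_multiplier multiplier_y Suc.IH
          A(2) even_family_partials(1)[OF Suc.prems(2) A(1)] Suc.prems) (use Suc.prems(3) in simp)
    ultimately show ?case
      using base[OF Suc.prems] smooth_family_zero unfolding smooth_family.simps by blast
  qed
  thus ?thesis unfolding tame_def by blast
qed

subsection \<open>The Dunkl transform of a family\<close>

lemma dunkl_kernel_eq_Complex:
  "dunkl_kernel k lam x = Complex (normalized_bessel k (lam * x))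
     (lam * x * normalized_bessel (k + 1) (lam * x) / (2 * (k + 1)))"
  by (simp add: dunkl_kernel_def complex_eq_iff)

lemma norm_dunkl_kernel_le: "k \<ge> - 1 / 2 \<Longrightarrow> norm (dunkl_kernel k lam x) \<le> 1"
  using normalized_bessel_energy[of k "lam * x"]
  by (simp add: dunkl_kernel_eq_Complex complex_norm)

lemma continuous_dunkl_kernel:
  "k \<ge> - 1 / 2 \<Longrightarrow> continuous_on UNIV (\<lambda>y. dunkl_kernel k lam y)"
  unfolding dunkl_kernel_eq_Complex Complex_eq by (intro continuous_intros) auto

definition dunkl_factor :: "real \<Rightarrow> real" where
  "dunkl_factor k = 1 / (2 powr (k + 1) * Gamma (k + 1))"

lemma dunkl_factor_nonneg: "k \<ge> - 1 / 2 \<Longrightarrow> 0 \<le> dunkl_factor k"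
  using Gamma_real_pos[of "k + 1"] by (auto simp: dunkl_factor_def)

text \<open>Passes from the Dunkl measure to Lebesgue measure with an explicit power weight, the
  form used by \<open>hankel\<close>.\<close>

lemma dunkl_measure_integrable:
  fixes F :: "real \<Rightarrow> complex"
  assumes "k \<ge> - 1 / 2" "continuous_on UNIV F"
    "integrable lborel (\<lambda>y. (\<bar>y\<bar> powr (2 * k + 1)) *\<^sub>R F y)"
  shows "integrable (dunkl_measure k) F"
    and "(LINT y|dunkl_measure k. F y) =
      of_real (dunkl_factor k) * (LINT y|lborel. (\<bar>y\<bar> powr (2 * k + 1)) *\<^sub>R F y)"
proof -
  have [measurable]: "F \<in> borel_measurable borel"
    using assms(2) by (rule borel_measurable_continuous_onI)
  have eq: "dunkl_measure k = density lborel (\<lambda>y. ennreal (dunkl_factor k * \<bar>y\<bar> powr (2 * k + 1)))"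
    by (simp add: dunkl_measure_def dunkl_factor_def)
  have nn: "AE y in lborel. 0 \<le> dunkl_factor k * \<bar>y\<bar> powr (2 * k + 1)"
    using dunkl_factor_nonneg[OF assms(1)] by simp
  have eq2: "(dunkl_factor k * \<bar>y\<bar> powr (2 * k + 1)) *\<^sub>R F y =
      of_real (dunkl_factor k) * ((\<bar>y\<bar> powr (2 * k + 1)) *\<^sub>R F y)" for y
    by (simp add: scaleR_conv_of_real)
  show "integrable (dunkl_measure k) F"
    unfolding eq
    by (subst integrable_density[OF _ _ nn], measurable)
      (unfold eq2, intro integrable_mult_right assms(3))
  show "(LINT y|dunkl_measure k. F y) =
      of_real (dunkl_factor k) * (LINT y|lborel. (\<bar>y\<bar> powr (2 * k + 1)) *\<^sub>R F y)"
    unfolding eq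
    by (subst integral_density[OF _ _ nn], measurable) (unfold eq2, rule integral_mult_right_zero)
qed

lemma dunkl_kernel_integrable:
  assumes "k \<ge> - 1 / 2" "tame A" "f \<in> schwartz_space"
  shows "integrable lborel (\<lambda>y. (\<bar>y\<bar> powr (2 * k + 1)) *\<^sub>R (A f x y * dunkl_kernel k lam y))"
    and "integrable (dunkl_measure k) (\<lambda>y. A f x y * dunkl_kernel k lam y)"
    and "(LINT y|dunkl_measure k. A f x y * dunkl_kernel k lam y) = of_real (dunkl_factor k) *
      (LINT y|lborel. (\<bar>y\<bar> powr (2 * k + 1)) *\<^sub>R (A f x y * dunkl_kernel k lam y))"
proof -
  show int: "integrable lborel (\<lambda>y. (\<bar>y\<bar> powr (2 * k + 1)) *\<^sub>R (A f x y * dunkl_kernel k lam y))"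
    using integrable_kernel[OF assms(2,3) _ continuous_dunkl_kernel[OF assms(1), of lam]
        norm_dunkl_kernel_le[OF assms(1)], of "2 * k + 1" x] assms(1)
    by (simp add: mult.commute)
  have "continuous_on UNIV (\<lambda>y. A f x y * dunkl_kernel k lam y)"
    by (intro continuous_intros tame_section_continuous continuous_dunkl_kernel assms)
  from dunkl_measure_integrable[OF assms(1) this int]
  show "integrable (dunkl_measure k) (\<lambda>y. A f x y * dunkl_kernel k lam y)"
    and "(LINT y|dunkl_measure k. A f x y * dunkl_kernel k lam y) = of_real (dunkl_factor k) *
      (LINT y|lborel. (\<bar>y\<bar> powr (2 * k + 1)) *\<^sub>R (A f x y * dunkl_kernel k lam y))" .
qed

text \<open>The even part of A pairs with j_k. Its odd part l B pairs with the odd part of the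
  kernel, which contains another l; the resulting l^2 raises the weight to that of order k +
  1.\<close>

lemma tame_dunkl_integral:
  assumes k: "k \<ge> - 1 / 2" and A: "tame A" and c: "c \<noteq> 0"
  shows "tame (\<lambda>f x y. LINT l|dunkl_measure k. A f y l * dunkl_kernel k (c * y) l)"
proof -
  define Ae where "Ae = (\<lambda>f x y. 1 / 2 * (A f x y + A f x (- y)))"
  define Ao where "Ao = (\<lambda>f x y. 1 / 2 * (A f x y + - 1 * A f x (- y)))"
  have tAe: "tame Ae" unfolding Ae_def by (intro tame_scale tame_add A tame_reflect)
  have eAe: "even_family Ae" by (auto simp: even_family_def Ae_def)
  have tAo: "tame Ao" unfolding Ao_def by (intro tame_scale tame_add A tame_reflect)
  have "Ao f x 0 = 0" for f x by (simp add: Ao_def)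
  then obtain B where B: "tame B" "\<And>f x y. f \<in> schwartz_space \<Longrightarrow> Ao f x y = of_real y * B f x y"
    using tame_divide[OF tAo] by metis
  have eB: "even_family B"
    unfolding even_family_def
  proof (intro ballI allI)
    fix f x y assume f: "f \<in> schwartz_space"
    show "B f x (- y) = B f x y"
    proof (cases "y = 0")
      case False
      have "of_real y * B f x (- y) = - Ao f x (- y)" using B(2)[OF f, of x "- y"] by simp
      also have "\<dots> = Ao f x y" by (simp add: Ao_def field_simps)
      also have "\<dots> = of_real y * B f x y" by (rule B(2)[OF f])
      finally show ?thesis using False by simp
    qed simp
  qed
  have "(LINT l|dunkl_measure k. A f y l * dunkl_kernel k (c * y) l) = of_real (dunkl_factor k) *
      (hankel c k Ae f y + \<i> * of_real (c / (2 * (k + 1))) * (of_real y * hankel c (k + 1) B f y))"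
    if f: "f \<in> schwartz_space" for f y
  proof -
    let ?w = "\<lambda>l::real. \<bar>l\<bar> powr (2 * k + 1)"
    define h where "h = (\<lambda>l. ?w l *\<^sub>R (A f y l * dunkl_kernel k (c * y) l))"
    have int: "integrable lborel h" unfolding h_def by (rule dunkl_kernel_integrable[OF k A f])
    have int': "integrable lborel (\<lambda>l. h (- l))"
      using lborel_integrable_real_affine[OF int, of "-1" 0] by simp
    \<comment> \<open>Averaging the whole integrand with its reflection removes the products of
      opposite parity pointwise, before the integral is split.\<close>
    have "(LINT l|lborel. h l) = 1 / 2 * ((LINT l|lborel. h l) + (LINT l|lborel. h (- l)))"
      unfolding integral_reflect_lborel by simp
    also have "\<dots> = (LINT l|lborel. 1 / 2 * (h l + h (- l)))"
      using int int' by simp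
    also have "\<dots> = (LINT l|lborel. ?w l *\<^sub>R (of_real (normalized_bessel k (c * y * l)) * Ae f y l) +
        (\<i> * of_real (c / (2 * (k + 1))) * of_real y) * (\<bar>l\<bar> powr (2 * (k + 1) + 1) *\<^sub>R
          (of_real (normalized_bessel (k + 1) (c * y * l)) * B f y l)))"
    proof (rule Bochner_Integration.integral_cong[OF refl])
      fix l :: real
      let ?J = "complex_of_real (normalized_bessel k (c * y * l))"
      let ?I = "\<i> * of_real (c * y * l) / of_real (2 * (k + 1)) * complex_of_real (normalized_bessel (k + 1) (c * y * l))"
      have w: "\<bar>l\<bar> powr (2 * (k + 1) + 1) = ?w l * l\<^sup>2"
        using abs_powr_Suc[of l "2 * k + 1 + 1"] abs_powr_Suc[of l "2 * k + 1"]
        by (simp add: algebra_simps power2_eq_square abs_mult_self_eq)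
      have E: "dunkl_kernel k (c * y) l = ?J + ?I" "dunkl_kernel k (c * y) (- l) = ?J - ?I"
        using k normalized_bessel_minus[of k "c * y * l"] normalized_bessel_minus[of "k + 1" "c * y * l"]
        by (simp_all add: dunkl_kernel_def)
      have "1 / 2 * (h l + h (- l)) = of_real (?w l) * (1 / 2 * (A f y l * (?J + ?I) + A f y (- l) * (?J - ?I)))"
        unfolding h_def E by (simp add: scaleR_conv_of_real distrib_left)
      also have "1 / 2 * (A f y l * (?J + ?I) + A f y (- l) * (?J - ?I)) = ?J * Ae f y l + ?I * Ao f y l"
      proof -
        have "1 / 2 * (a * (j + i) + b * (j - i)) = j * (1 / 2 * (a + b)) + i * (1 / 2 * (a + - 1 * b))"
          for a b i j :: complex
          by (simp add: algebra_simps add_divide_distrib diff_divide_distrib)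
        thus ?thesis unfolding Ae_def Ao_def .
      qed
      also have "of_real (?w l) * (?J * Ae f y l + ?I * Ao f y l) =
          ?w l *\<^sub>R (?J * Ae f y l) + (\<i> * of_real (c / (2 * (k + 1))) * of_real y) *
          (\<bar>l\<bar> powr (2 * (k + 1) + 1) *\<^sub>R (of_real (normalized_bessel (k + 1) (c * y * l)) * B f y l))"
        unfolding B(2)[OF f] w by (simp add: scaleR_conv_of_real distrib_left power2_eq_square)
      finally show "1 / 2 * (h l + h (- l)) = \<dots>" .
    qed
    also have "\<dots> = hankel c k Ae f y + (\<i> * of_real (c / (2 * (k + 1))) * of_real y) * hankel c (k + 1) B f y"
      unfolding hankel_def
      by (rule integral_add_mult[OF hankel_integrable[OF tAe f k] hankel_integrable[OF B(1) f]]) (use k in simp)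
    finally show ?thesis
      unfolding dunkl_kernel_integrable(3)[OF k A f] h_def by (simp add: mult.assoc)
  qed
  moreover have "tame (\<lambda>f x y. of_real (dunkl_factor k) *
      (hankel c k Ae f y + \<i> * of_real (c / (2 * (k + 1))) * (of_real y * hankel c (k + 1) B f y)))"
    by (intro tame_scale tame_add tame_multiplier[where m="\<lambda>x y. of_real y"] multiplier_y tame_hankel c
        tAe eAe B(1) eB) (use k in auto)
  ultimately show ?thesis by (auto elim: tame_cong)
qed

subsection \<open>Tame families and the Schwartz space\<close>

lemma iter_deriv_Suc:
  "iter_deriv (Suc n) f = (\<lambda>x. vector_derivative (iter_deriv n f) (at x))"
  by (simp add: iter_deriv_def)

lemma schwartz_has_derivative:
  "f \<in> schwartz_space \<Longrightarrow> (iter_deriv n f has_vector_derivative iter_deriv (Suc n) f x) (at x)"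
  by (simp add: iter_deriv_Suc schwartz_space_def vector_derivative_works)

lemma gauge_fun_seminorm: "gauge_fun (schwartz_seminorm l n)"
  unfolding gauge_fun_def using schwartz_seminorm_le_norm
  by (intro exI[of _ 1] exI[of _ "max l n"]) auto

text \<open>Starting point of all estimates: the gauge of y^p times the n-th derivative of f is the
  corresponding Schwartz seminorm.\<close>

lemma tame_id: "tame (\<lambda>f x y. f y)"
proof -
  have "smooth_family UNIV N (\<lambda>f x y. iter_deriv n f y)" for N n
  proof (induction N arbitrary: n)
    case 0
    have "gauged (\<lambda>f x y. of_real (y ^ p) * iter_deriv n f y)" for p
      unfolding gauged_def using gauge_fun_seminorm schwartz_seminorm_upper by blast
    moreover have "continuous_on UNIV (\<lambda>z::real \<times> real. iter_deriv n f (snd z))"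
      if f: "f \<in> schwartz_space" for f
    proof -
      have "continuous_on UNIV (iter_deriv n f)"
        using schwartz_has_derivative[OF f] has_vector_derivative_continuous
        by (blast intro: continuous_at_imp_continuous_on)
      from continuous_on_compose2[OF this continuous_on_snd[OF continuous_on_id]]
      show ?thesis by simp
    qed
    ultimately show ?case unfolding smooth_family.simps gauged_continuous_def by blast
  next
    case (Suc N)
    have "partials (\<lambda>f x y. iter_deriv n f y) (\<lambda>f x y. 0) (\<lambda>f x y. iter_deriv (Suc n) f y)"
      using schwartz_has_derivative by (simp add: partials_def)
    thus ?case
      using Suc smooth_family_zero smooth_family_base[OF Suc] unfolding smooth_family.simps by blast
  qed
  from this[of _ 0] show ?thesis by (simp add: tame_def iter_deriv_def)
qed

lemma tame_iter_deriv:
  assumes "tame (\<lambda>f x y. W f y)"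
  shows "\<exists>V. tame (\<lambda>f x y. V f y) \<and> (\<forall>f\<in>schwartz_space. iter_deriv n (W f) = V f)"
proof (induction n)
  case 0
  show ?case using assms by (intro exI[of _ W]) (simp add: iter_deriv_def)
next
  case (Suc n)
  then obtain V where V: "tame (\<lambda>f x y. V f y)" "\<forall>f\<in>schwartz_space. iter_deriv n (W f) = V f" by blast
  obtain A1 A2 where A: "partials (\<lambda>f x y. V f y) A1 A2" "tame A2"
    using tame_partials[OF V(1)] by blast
  have d: "(V f has_vector_derivative A2 f x y) (at y)" if "f \<in> schwartz_space" for f x y
    using A(1) that by (auto simp: partials_def)
  \<comment> \<open>The derivative family formally has a parameter. As \<open>V\<close> does not
    depend on it, uniqueness of derivatives allows it to be frozen at 0.\<close>
  have eq: "A2 f x y = A2 f 0 y" if "f \<in> schwartz_space" for f x y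
    by (rule vector_derivative_unique_at[OF d d]) (use that in auto)
  have "tame (\<lambda>f x y. A2 f 0 y)" by (rule tame_cong[OF A(2) eq])
  moreover have "\<forall>f\<in>schwartz_space. iter_deriv (Suc n) (W f) = A2 f 0"
    using V(2) vector_derivative_at[OF d[where x=0]] by (simp add: iter_deriv_Suc)
  ultimately show ?case by (intro exI[of _ "\<lambda>f. A2 f 0"]) auto
qed

text \<open>Converts tameness back: y-decay of every derivative is membership in the Schwartz space,
  and the gauges are the seminorm estimates required for continuity.\<close>

lemma tame_schwartz:
  assumes "tame (\<lambda>f x y. W f y)"
  shows "f \<in> schwartz_space \<Longrightarrow> W f \<in> schwartz_space"
    and "gauge_fun (\<lambda>f. schwartz_seminorm l n (W f))"
proof -
  assume f: "f \<in> schwartz_space"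
  show "W f \<in> schwartz_space"
    unfolding schwartz_space_def
  proof (intro CollectI conjI allI)
    fix n x
    obtain V where V: "tame (\<lambda>f x y. V f y)" "\<forall>f\<in>schwartz_space. iter_deriv n (W f) = V f"
      using tame_iter_deriv[OF assms] by blast
    obtain A1 A2 where "partials (\<lambda>f x y. V f y) A1 A2" using tame_partials[OF V(1)] by blast
    hence "(V f has_vector_derivative A2 f x x) (at x)" using f by (auto simp: partials_def)
    thus "iter_deriv n (W f) differentiable at x"
      using V(2) f by (auto intro: differentiableI_vector)
  next
    fix l n
    obtain V where V: "tame (\<lambda>f x y. V f y)" "\<forall>f\<in>schwartz_space. iter_deriv n (W f) = V f"
      using tame_iter_deriv[OF assms] by blast
    obtain g where "\<forall>f\<in>schwartz_space. \<forall>x y::real. norm (of_real (y ^ l) * V f y) \<le> g f"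
      using tame_gauged[OF V(1), of l] unfolding gauged_def by blast
    thus "bounded (range (\<lambda>x. of_real (x ^ l) * iter_deriv n (W f) x))"
      unfolding bounded_iff using V(2) f by auto
  qed
next
  obtain V where V: "tame (\<lambda>f x y. V f y)" "\<forall>f\<in>schwartz_space. iter_deriv n (W f) = V f"
    using tame_iter_deriv[OF assms] by blast
  obtain g where g: "gauge_fun g" "\<forall>f\<in>schwartz_space. \<forall>x y::real. norm (of_real (y ^ l) * V f y) \<le> g f"
    using tame_gauged[OF V(1), of l] unfolding gauged_def by blast
  show "gauge_fun (\<lambda>f. schwartz_seminorm l n (W f))"
  proof (rule gauge_fun_le[OF g(1), of 1])
    fix f assume "f \<in> schwartz_space"
    thus "schwartz_seminorm l n (W f) \<le> 1 * g f"
      using V(2) g(2) unfolding schwartz_seminorm_def by (intro cSUP_least) auto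
  qed simp
qed

section \<open>Linear combinations of Schwartz functions and a continuity criterion\<close>

lemma iter_deriv_lincomb:
  assumes "f \<in> schwartz_space" "g \<in> schwartz_space"
  shows "iter_deriv n (\<lambda>x. f x + c * g x) = (\<lambda>x. iter_deriv n f x + c * iter_deriv n g x)"
proof (induction n)
  case (Suc n)
  have "((\<lambda>x. iter_deriv n f x + c * iter_deriv n g x) has_vector_derivative
      iter_deriv (Suc n) f x + c * iter_deriv (Suc n) g x) (at x)" for x
    by (intro has_vector_derivative_add has_vector_derivative_mult_right schwartz_has_derivative assms)
  thus ?case unfolding iter_deriv_Suc[of n "\<lambda>x. f x + c * g x"] Suc
    by (auto simp: fun_eq_iff intro!: vector_derivative_at)
qed (simp add: iter_deriv_def)

lemma schwartz_lincomb_bound: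
  assumes "f \<in> schwartz_space" "g \<in> schwartz_space"
  shows "norm (of_real (x ^ l) * iter_deriv n (\<lambda>x. f x + c * g x) x) \<le>
     schwartz_seminorm l n f + norm c * schwartz_seminorm l n g"
proof -
  have "norm (of_real (x ^ l) * iter_deriv n (\<lambda>x. f x + c * g x) x) =
      norm (of_real (x ^ l) * iter_deriv n f x + c * (of_real (x ^ l) * iter_deriv n g x))"
    by (simp add: iter_deriv_lincomb[OF assms] algebra_simps)
  also have "\<dots> \<le> norm (of_real (x ^ l) * iter_deriv n f x) + norm (c * (of_real (x ^ l) * iter_deriv n g x))"
    by (rule norm_triangle_ineq)
  also have "\<dots> \<le> schwartz_seminorm l n f + norm c * schwartz_seminorm l n g"
    unfolding norm_mult[of c] by (intro add_mono mult_left_mono schwartz_seminorm_upper assms) auto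
  finally show ?thesis .
qed

lemma schwartz_lincomb:
  assumes "f \<in> schwartz_space" "g \<in> schwartz_space"
  shows "(\<lambda>x. f x + c * g x) \<in> schwartz_space"
  unfolding schwartz_space_def
proof (intro CollectI conjI allI)
  fix n x
  show "iter_deriv n (\<lambda>x. f x + c * g x) differentiable at x"
    unfolding iter_deriv_lincomb[OF assms]
    by (rule differentiableI_vector[OF has_vector_derivative_add[OF schwartz_has_derivative[OF assms(1)]
            has_vector_derivative_mult_right[OF schwartz_has_derivative[OF assms(2)]]]])
  show "bounded (range (\<lambda>x. of_real (x ^ l) * iter_deriv n (\<lambda>x. f x + c * g x) x))" for l
    unfolding bounded_iff using schwartz_lincomb_bound[OF assms] by blast
qed

lemma schwartz_seminorm_lincomb:
  assumes "f \<in> schwartz_space" "g \<in> schwartz_space"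
  shows "schwartz_seminorm l n (\<lambda>x. f x + c * g x) \<le>
     schwartz_seminorm l n f + norm c * schwartz_seminorm l n g"
  unfolding schwartz_seminorm_def[of l n "\<lambda>x. f x + c * g x"]
  by (intro cSUP_least schwartz_lincomb_bound assms) auto

lemma schwartz_diff:
  assumes "f \<in> schwartz_space" "g \<in> schwartz_space"
  shows "(\<lambda>x. f x - g x) \<in> schwartz_space"
  using schwartz_lincomb[OF assms, of "-1"] by simp

lemma openin_schwartz_ball:
  assumes "f \<in> schwartz_space" "0 < e"
  shows "openin schwartz_topology {g \<in> schwartz_space. schwartz_seminorm l n (\<lambda>x. g x - f x) < e}"
  unfolding schwartz_topology_def using assms by (intro topology_generated_by_Basis) blast

text \<open>Preimages of subbasic balls are open because T f - h = (T f0 - h) + T (f - f0), where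
  the last term is small once f - f0 is small in finitely many seminorms.\<close>

lemma continuous_map_schwartz:
  assumes T: "\<And>f. f \<in> schwartz_space \<Longrightarrow> T f \<in> schwartz_space"
    and diff: "\<And>f g. f \<in> schwartz_space \<Longrightarrow> g \<in> schwartz_space \<Longrightarrow>
      T (\<lambda>x. f x - g x) = (\<lambda>x. T f x - T g x)"
    and gauge: "\<And>l n. gauge_fun (\<lambda>f. schwartz_seminorm l n (T f))"
  shows "continuous_map schwartz_topology schwartz_topology T"
proof -
  have op: "openin schwartz_topology
      (T -` {g \<in> schwartz_space. schwartz_seminorm l n (\<lambda>x. g x - h x) < e} \<inter> topspace schwartz_topology)"
    if h: "h \<in> schwartz_space" and e: "0 < e" for h l n e
  proof (subst openin_subopen, intro ballI)
    fix f0 assume "f0 \<in> T -` {g \<in> schwartz_space. schwartz_seminorm l n (\<lambda>x. g x - h x) < e} \<inter>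
      topspace schwartz_topology"
    hence f0: "f0 \<in> schwartz_space" "schwartz_seminorm l n (\<lambda>x. T f0 x - h x) < e"
      by (auto simp: topspace_schwartz_topology)
    obtain C N where C: "0 \<le> C" "\<forall>f\<in>schwartz_space. schwartz_seminorm l n (T f) \<le> C * schwartz_norm N f"
      using gauge[of l n] unfolding gauge_fun_def by blast
    define r where "r = e - schwartz_seminorm l n (\<lambda>x. T f0 x - h x)"
    have r: "0 < r" using f0 by (simp add: r_def)
    \<comment> \<open>\<open>schwartz_norm N\<close> is a sum of (N + 1)^2 seminorms. Using C + 1 in
      place of C keeps K positive and the final estimate strict even when C = 0.\<close>
    define K where "K = (C + 1) * (real (Suc N) * real (Suc N))"
    have K: "0 < K" unfolding K_def by (intro mult_pos_pos) (use C in auto)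
    define V where "V = (\<Inter>p\<in>{..N} \<times> {..N}.
      {f \<in> schwartz_space. schwartz_seminorm (fst p) (snd p) (\<lambda>x. f x - f0 x) < r / K})"
    have "openin schwartz_topology V"
      unfolding V_def
      by (intro openin_INT2 openin_schwartz_ball f0) (use r K in auto)
    moreover have "f0 \<in> V"
    proof -
      have "schwartz_seminorm i j (\<lambda>x. f0 x - f0 x) = 0" for i j
        using iter_deriv_lincomb[OF f0(1) f0(1), of j "-1"] by (simp add: schwartz_seminorm_def)
      thus ?thesis unfolding V_def using f0(1) r K by simp
    qed
    moreover have "V \<subseteq> T -` {g \<in> schwartz_space. schwartz_seminorm l n (\<lambda>x. g x - h x) < e} \<inter>
      topspace schwartz_topology"
    proof
      fix f assume fV: "f \<in> V"
      hence f: "f \<in> schwartz_space" by (auto simp: V_def)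
      note d = schwartz_diff[OF f f0(1)]
      have "schwartz_norm N (\<lambda>x. f x - f0 x) \<le> (\<Sum>i\<le>N. \<Sum>j\<le>N. r / K)"
        unfolding schwartz_norm_def using fV by (intro sum_mono) (auto simp: V_def less_imp_le)
      also have "\<dots> = real (Suc N) * real (Suc N) * (r / K)" by simp
      finally have nle: "schwartz_norm N (\<lambda>x. f x - f0 x) \<le> real (Suc N) * real (Suc N) * (r / K)" .
      have "schwartz_seminorm l n (T (\<lambda>x. f x - f0 x)) \<le> C * schwartz_norm N (\<lambda>x. f x - f0 x)"
        using C(2) d by blast
      also have "\<dots> \<le> C * (real (Suc N) * real (Suc N) * (r / K))"
        by (rule mult_left_mono[OF nle C(1)])
      also have "\<dots> < (C + 1) * (real (Suc N) * real (Suc N) * (r / K))"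
        by (rule mult_strict_right_mono) (use r K in auto)
      also have "\<dots> = K * (r / K)" by (simp only: K_def mult.assoc)
      also have "\<dots> = r" using K by simp
      finally have small: "schwartz_seminorm l n (T (\<lambda>x. f x - f0 x)) < r" .
      have eq: "(\<lambda>x. T f x - h x) = (\<lambda>x. (T f0 x - h x) + 1 * T (\<lambda>x. f x - f0 x) x)"
        unfolding diff[OF f f0(1)] by auto
      have "schwartz_seminorm l n (\<lambda>x. T f x - h x) \<le>
          schwartz_seminorm l n (\<lambda>x. T f0 x - h x) + norm (1::complex) * schwartz_seminorm l n (T (\<lambda>x. f x - f0 x))"
        unfolding eq by (intro schwartz_seminorm_lincomb schwartz_diff T f0 h d)
      also have "\<dots> < e" using small by (simp add: r_def)
      finally show "f \<in> T -` {g \<in> schwartz_space. schwartz_seminorm l n (\<lambda>x. g x - h x) < e} \<inter>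
          topspace schwartz_topology"
        using f T by (simp add: topspace_schwartz_topology)
    qed
    ultimately show "\<exists>V. openin schwartz_topology V \<and> f0 \<in> V \<and>
        V \<subseteq> T -` {g \<in> schwartz_space. schwartz_seminorm l n (\<lambda>x. g x - h x) < e} \<inter> topspace schwartz_topology"
      by blast
  qed
  show ?thesis
    unfolding schwartz_topology_def
  proof (rule continuous_on_generated_topo, fold schwartz_topology_def)
    show "T ` topspace schwartz_topology \<subseteq> \<Union> {{g \<in> schwartz_space. schwartz_seminorm l n (\<lambda>x. g x - f x) < e} |
        f l n e. f \<in> schwartz_space \<and> 0 < e}"
      using topspace_schwartz_topology T
      unfolding schwartz_topology_def topology_generated_by_topspace by auto
  qed (use op in blast)
qed

subsection \<open>Symbols are multipliers\<close>

definition C_infinity :: "(real \<Rightarrow> real \<Rightarrow> complex) \<Rightarrow> bool" where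
  "C_infinity \<sigma> \<longleftrightarrow> (\<forall>N. C_class N \<sigma>)"

lemma C_infinity_continuous:
  "C_infinity \<sigma> \<Longrightarrow> continuous_on UNIV (\<lambda>z. \<sigma> (fst z) (snd z))"
  unfolding C_infinity_def by (drule spec[of _ 0]) (simp add: case_prod_beta')

lemma C_infinity_pdiff:
  assumes "C_infinity \<sigma>"
  shows "C_infinity (pdiff1 \<sigma>)" "C_infinity (pdiff2 \<sigma>)"
  using assms unfolding C_infinity_def by (metis C_class.simps(2))+

lemma C_infinity_joint_partials:
  assumes "C_infinity \<sigma>"
  shows "joint_partials \<sigma> (pdiff1 \<sigma>) (pdiff2 \<sigma>)"
  using assms[unfolded C_infinity_def, rule_format, of "Suc 0"]
  by (simp add: joint_partials_def pdiff1_def pdiff2_def flip: vector_derivative_works)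

text \<open>Differentiate \<open>\<sigma>(x, t) - \<sigma>(x, y - 1) = \<integral> \<partial>\<^sub>2 \<sigma>(x, u) du\<close> in \<open>x\<close>, then in \<open>t\<close>.\<close>

lemma pdiff_commute:
  assumes "C_infinity \<sigma>"
  shows "pdiff2 (pdiff1 \<sigma>) = pdiff1 (pdiff2 \<sigma>)"
proof (intro ext)
  fix x y :: real
  let ?s1 = "pdiff1 \<sigma>" and ?s2 = "pdiff2 \<sigma>"
  let ?s12 = "pdiff1 (pdiff2 \<sigma>)"
  note smooth = assms C_infinity_pdiff[OF assms] C_infinity_pdiff(1)[OF C_infinity_pdiff(2)[OF assms]]
  note c = smooth[THEN C_infinity_continuous]
  have d: "((\<lambda>s. \<sigma> s t) has_vector_derivative ?s1 u t) (at u)"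
    "((\<lambda>t. \<sigma> u t) has_vector_derivative ?s2 u t) (at t)"
    "((\<lambda>s. ?s2 s t) has_vector_derivative ?s12 u t) (at u)" for u t
    using C_infinity_joint_partials[OF smooth(1)] C_infinity_joint_partials[OF smooth(3)]
    by (auto simp: joint_partials_def)
  \<comment> \<open>The base point y - 1 makes y interior to the range of integration, so the
    derivative in t at y is two-sided.\<close>
  have eq: "?s1 x t - ?s1 x (y - 1) = integral {y - 1..t} (?s12 x)" if t: "y - 1 \<le> t" for t
  proof -
    have i: "\<sigma> u t - \<sigma> u (y - 1) = integral {y - 1..t} (?s2 u)" for u
      by (intro integral_unique[symmetric] fundamental_theorem_of_calculus t
          has_vector_derivative_at_within[OF d(2)])
    have "((\<lambda>u. integral (cbox (y - 1) t) (?s2 u)) has_vector_derivative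
        integral (cbox (y - 1) t) (?s12 x)) (at x within UNIV)"
    proof (rule leibniz_rule_vector_derivative)
      show "continuous_on (UNIV \<times> cbox (y - 1) t) (\<lambda>(u, v). ?s12 u v)"
        unfolding case_prod_beta by (intro continuous_on_pair_comp[OF c(4)] continuous_intros)
      show "?s2 u integrable_on cbox (y - 1) t" for u
        by (intro integrable_continuous continuous_on_pair_comp[OF c(3), of _ "\<lambda>_. u"] continuous_intros)
    qed (use d(3) in auto)
    hence "((\<lambda>u. \<sigma> u t - \<sigma> u (y - 1)) has_vector_derivative integral {y - 1..t} (?s12 x)) (at x)"
      unfolding i by simp
    moreover have "((\<lambda>u. \<sigma> u t - \<sigma> u (y - 1)) has_vector_derivative ?s1 x t - ?s1 x (y - 1)) (at x)"
      by (intro has_vector_derivative_diff d(1))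
    ultimately show ?thesis by (rule vector_derivative_unique_at[symmetric])
  qed
  have "continuous_on {y - 1..y + 1} (?s12 x)"
    by (intro continuous_on_pair_comp[OF c(4), of _ "\<lambda>_. x"] continuous_intros)
  from integral_has_vector_derivative[OF this, of y]
  have "((\<lambda>t. integral {y - 1..t} (?s12 x)) has_vector_derivative ?s12 x y) (at y within {y - 1..y + 1})"
    by simp
  hence "((\<lambda>t. ?s1 x (y - 1) + integral {y - 1..t} (?s12 x)) has_vector_derivative 0 + ?s12 x y) (at y)"
    by (intro has_vector_derivative_add has_vector_derivative_const) (simp add: at_within_Icc_at)
  hence "((\<lambda>t. ?s1 x t) has_vector_derivative 0 + ?s12 x y) (at y)"
  proof (rule has_vector_derivative_transform_within_open[of _ _ _ "{y - 1<..}"])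
    fix t assume "t \<in> {y - 1<..}"
    thus "?s1 x (y - 1) + integral {y - 1..t} (?s12 x) = ?s1 x t"
      using eq[of t] by (simp add: algebra_simps)
  qed auto
  thus "pdiff2 ?s1 x y = ?s12 x y"
    unfolding pdiff2_def[of ?s1] by (simp add: vector_derivative_at)
qed

lemma C_infinity_pdiff_iter:
  "C_infinity \<sigma> \<Longrightarrow> C_infinity ((pdiff1 ^^ l) ((pdiff2 ^^ n) \<sigma>))"
proof (induction l)
  case 0
  thus ?case by (induction n) (auto intro: C_infinity_pdiff)
qed (auto intro: C_infinity_pdiff)

text \<open>The symbol bounds are stated with the \<open>pdiff2\<close> derivatives applied first;
  this moves a further outer one inside.\<close>

lemma pdiff2_pdiff1_iter:
  "C_infinity \<sigma> \<Longrightarrow> pdiff2 ((pdiff1 ^^ l) \<sigma>) = (pdiff1 ^^ l) (pdiff2 \<sigma>)"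
proof (induction l)
  case (Suc l)
  have "C_infinity ((pdiff1 ^^ l) \<sigma>)" using C_infinity_pdiff_iter[OF Suc.prems, of l 0] by simp
  from pdiff_commute[OF this] Suc show ?case by simp
qed simp

text \<open>The base is at least 1, so a real exponent of either sign may be raised to an integer
  above its absolute value; then 1 + y^2 <= (1 + |y|)^2.\<close>

lemma japanese_bracket_powr_le: "(1 + \<bar>y\<bar>\<^sup>2) powr e \<le> (1 + \<bar>y\<bar>) ^ (2 * nat \<lceil>\<bar>e\<bar>\<rceil>)" for y e :: real
proof -
  have "(1 + \<bar>y\<bar>\<^sup>2) powr e \<le> (1 + \<bar>y\<bar>\<^sup>2) powr real (nat \<lceil>\<bar>e\<bar>\<rceil>)"
    by (intro powr_mono) (auto, linarith)
  also have "\<dots> = (1 + \<bar>y\<bar>\<^sup>2) ^ nat \<lceil>\<bar>e\<bar>\<rceil>"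
    by (rule powr_realpow) (simp add: add_pos_nonneg)
  also have "\<dots> \<le> ((1 + \<bar>y\<bar>)\<^sup>2) ^ nat \<lceil>\<bar>e\<bar>\<rceil>"
    by (intro power_mono) (auto simp: power2_sum)
  finally show ?thesis by (simp add: power_mult)
qed

text \<open>The induction treats all mixed derivatives at once, a set closed under both partial
  derivatives by their commutation.\<close>

lemma multiplier_symbol:
  assumes "\<sigma> \<in> symbol_class m"
  shows "multiplier N \<sigma>"
proof -
  have smooth: "C_infinity \<sigma>" using assms by (simp add: symbol_class_def C_infinity_def)
  have "multiplier N ((pdiff1 ^^ l) ((pdiff2 ^^ n) \<sigma>))" for l n
  proof (induction N arbitrary: l n)
    case 0
    obtain C where C: "\<And>x y. norm ((pdiff1 ^^ l) ((pdiff2 ^^ n) \<sigma>) x y) \<le>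
        C * (1 + \<bar>y\<bar>\<^sup>2) powr ((m - real n) / 2)"
      using assms unfolding symbol_class_def by blast
    have "norm ((pdiff1 ^^ l) ((pdiff2 ^^ n) \<sigma>) x y) \<le>
        \<bar>C\<bar> * (1 + \<bar>y\<bar>) ^ (2 * nat \<lceil>\<bar>(m - real n) / 2\<bar>\<rceil>)" for x y
    proof -
      have "norm ((pdiff1 ^^ l) ((pdiff2 ^^ n) \<sigma>) x y) \<le> \<bar>C\<bar> * (1 + \<bar>y\<bar>\<^sup>2) powr ((m - real n) / 2)"
        by (rule order_trans[OF C]) (intro mult_right_mono, auto)
      also have "\<dots> \<le> \<bar>C\<bar> * (1 + \<bar>y\<bar>) ^ (2 * nat \<lceil>\<bar>(m - real n) / 2\<bar>\<rceil>)"
        by (intro mult_left_mono japanese_bracket_powr_le) auto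
      finally show ?thesis .
    qed
    thus ?case
      using C_infinity_continuous[OF C_infinity_pdiff_iter[OF smooth]]
      unfolding multiplier.simps poly_bounded_def by blast
  next
    case (Suc N)
    let ?s = "\<lambda>l n. (pdiff1 ^^ l) ((pdiff2 ^^ n) \<sigma>)"
    have "C_infinity ((pdiff2 ^^ n) \<sigma>)" using C_infinity_pdiff_iter[OF smooth, of 0 n] by simp
    hence "pdiff2 (?s l n) = ?s l (Suc n)" by (simp add: pdiff2_pdiff1_iter)
    hence "joint_partials (?s l n) (?s (Suc l) n) (?s l (Suc n))"
      using C_infinity_joint_partials[OF C_infinity_pdiff_iter[OF smooth, of l n]] by simp
    moreover have "poly_bounded (?s l n)" by (rule multiplier_base[OF Suc.IH])
    ultimately show ?case
      using Suc.IH[of "Suc l" n] Suc.IH[of l "Suc n"] unfolding multiplier.simps by blast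
  qed
  from this[of 0 0] show ?thesis by simp
qed

subsection \<open>The pseudo-differential operator\<close>

definition chirp :: "real \<Rightarrow> real \<Rightarrow> complex" where
  "chirp r y = exp (\<i> * of_real (r * y\<^sup>2))"

lemma tame_chirp: "tame A \<Longrightarrow> tame (\<lambda>f x y. chirp r y * A f x y)"
  unfolding chirp_def by (rule tame_multiplier[OF _ multiplier_chirp])

lemma exp_eq_chirp: "exp (\<i> / 2 * of_real (p * u\<^sup>2 + q * v\<^sup>2)) = chirp (p / 2) u * chirp (q / 2) v"
  by (simp add: chirp_def algebra_simps flip: exp_add)

text \<open>Separates the chirp in the output variable, which leaves the integral as a factor, from
  the chirp in the integration variable, which joins the integrand. What remains is a Dunkl kernel
  with scale c = -1/b.\<close>

lemma lc_dunkl_kernel_eq: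
  "lc_dunkl_kernel k M lam x = chirp (M $ 2 $ 2 / M $ 1 $ 2 / 2) lam *
     (chirp (M $ 1 $ 1 / M $ 1 $ 2 / 2) x * dunkl_kernel k (- 1 / M $ 1 $ 2 * lam) x)"
  unfolding lc_dunkl_kernel_def exp_eq_chirp by simp

lemma lc_dunkl_kernel_inv_eq:
  assumes "det M = 1"
  shows "lc_dunkl_kernel k (matrix_inv M) x lam = chirp (- (M $ 1 $ 1 / M $ 1 $ 2) / 2) x *
     (chirp (- (M $ 2 $ 2 / M $ 1 $ 2) / 2) lam * dunkl_kernel k (1 / M $ 1 $ 2 * x) lam)"
proof -
  have "- \<i> / 2 * complex_of_real (p * u + q * v) = \<i> / 2 * complex_of_real (- p * u + - q * v)"
    for p q u v by (simp add: algebra_simps)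
  thus ?thesis
    unfolding lc_dunkl_kernel_matrix_inv[OF assms] by (simp only: exp_eq_chirp mult.assoc) simp
qed

text \<open>Integrability is part of the conclusion because the integral of a non-integrable
  function is 0 by convention; it certifies that both integrals have their intended meaning.\<close>

theorem corollary3p5:
  fixes k m :: real and M :: "real^2^2" and \<sigma> :: "real \<Rightarrow> real \<Rightarrow> complex"
  assumes "k \<ge> - 1 / 2"
    and "det M = 1"
    and "M $ 1 $ 2 \<noteq> 0"
    and "\<sigma> \<in> symbol_class m"
  shows "(\<forall>f\<in>schwartz_space.
            (\<forall>lam. integrable (dunkl_measure k) (\<lambda>x. f x * lc_dunkl_kernel k M lam x)) \<and>
            (\<forall>x. integrable (dunkl_measure k)
               (\<lambda>lam. \<sigma> x lam * lc_dunkl_transform k M f lam * lc_dunkl_kernel k (matrix_inv M) x lam)))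
       \<and> pseudo_diff_op k M \<sigma> \<in> schwartz_space \<rightarrow> schwartz_space
       \<and> (\<forall>f\<in>schwartz_space. \<forall>g\<in>schwartz_space.
            pseudo_diff_op k M \<sigma> (\<lambda>x. f x + g x) =
              (\<lambda>x. pseudo_diff_op k M \<sigma> f x + pseudo_diff_op k M \<sigma> g x))
       \<and> (\<forall>c. \<forall>f\<in>schwartz_space.
            pseudo_diff_op k M \<sigma> (\<lambda>x. c * f x) = (\<lambda>x. c * pseudo_diff_op k M \<sigma> f x))
       \<and> continuous_map schwartz_topology schwartz_topology (pseudo_diff_op k M \<sigma>)"
proof -
  define b where "b = M $ 1 $ 2"
  define r1 where "r1 = M $ 1 $ 1 / b / 2"
  define r2 where "r2 = M $ 2 $ 2 / b / 2"
  have b: "- 1 / b \<noteq> 0" "1 / b \<noteq> 0" using assms(3) by (auto simp: b_def)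
  define K where "K = 1 / ((\<i> * complex_of_real (M $ 1 $ 2)) powr of_real (k + 1))"
  let ?P = "pseudo_diff_op k M \<sigma>" and ?D = "lc_dunkl_transform k M"
  let ?S = schwartz_space
  have ker: "lc_dunkl_kernel k M lam x = chirp r2 lam * (chirp r1 x * dunkl_kernel k (- 1 / b * lam) x)"
    for lam x unfolding r1_def r2_def b_def by (rule lc_dunkl_kernel_eq)
  have ker_inv: "lc_dunkl_kernel k (matrix_inv M) x lam =
      chirp (- r1) x * (chirp (- r2) lam * dunkl_kernel k (1 / b * x) lam)" for lam x
    unfolding r1_def r2_def b_def using lc_dunkl_kernel_inv_eq[OF assms(2)] by simp

  define A where "A = (\<lambda>(f::real \<Rightarrow> complex) (x::real) y. chirp r1 y * f y)"
  have A: "tame A" unfolding A_def by (intro tame_chirp tame_id)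
  \<comment> \<open>\<open>A\<close> ignores its parameter, so u is free. Choosing it as the output
    point gives the shape required by \<open>tame_dunkl_integral\<close>; the integrability proof
    takes u = 0.\<close>
  have eqA: "f x * lc_dunkl_kernel k M lam x = chirp r2 lam * (A f u x * dunkl_kernel k (- 1 / b * lam) x)"
    for f u x lam by (simp add: A_def ker)
  have D_eq: "?D f y = K * (chirp r2 y * (LINT l|dunkl_measure k. A f y l * dunkl_kernel k (- 1 / b * y) l))"
    for f y unfolding lc_dunkl_transform_def K_def eqA[of _ _ _ y] by simp
  have D: "tame (\<lambda>f x y. ?D f y)"
    unfolding D_eq by (intro tame_scale tame_chirp tame_dunkl_integral assms(1) A b)

  \<comment> \<open>Here the parameter becomes genuine: the symbol is evaluated at the output point
    x while y is integrated.\<close>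
  define B where "B = (\<lambda>f x y. \<sigma> x y * (chirp (- r2) y * ?D f y))"
  have B: "tame B"
    unfolding B_def by (intro tame_multiplier[OF _ multiplier_symbol[OF assms(4)]] tame_chirp D)
  have eqB: "\<sigma> x lam * ?D f lam * lc_dunkl_kernel k (matrix_inv M) x lam =
      chirp (- r1) x * (B f x lam * dunkl_kernel k (1 / b * x) lam)" for f x lam
    by (simp add: B_def ker_inv)
  have P_eq: "?P f y = chirp (- r1) y * (LINT l|dunkl_measure k. B f y l * dunkl_kernel k (1 / b * y) l)"
    for f y unfolding pseudo_diff_op_def eqB by simp
  have P: "tame (\<lambda>f x y. ?P f y)"
    unfolding P_eq by (intro tame_chirp tame_dunkl_integral assms(1) B b)

  have int1: "integrable (dunkl_measure k) (\<lambda>x. f x * lc_dunkl_kernel k M lam x)"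
    if "f \<in> ?S" for f lam
    unfolding eqA[of _ _ _ 0]
    by (intro integrable_mult_right dunkl_kernel_integrable(2)[OF assms(1) A that])
  have int2: "integrable (dunkl_measure k)
      (\<lambda>lam. \<sigma> x lam * ?D f lam * lc_dunkl_kernel k (matrix_inv M) x lam)" if "f \<in> ?S" for f x
    unfolding eqB by (intro integrable_mult_right dunkl_kernel_integrable(2)[OF assms(1) B that])

  have D_add: "?D (\<lambda>x. f x + g x) lam = ?D f lam + ?D g lam" if "f \<in> ?S" "g \<in> ?S" for f g lam
    unfolding lc_dunkl_transform_def using int1[OF that(1)] int1[OF that(2)]
    by (simp add: distrib_right distrib_left add_divide_distrib)
  have D_scale: "?D (\<lambda>x. c * f x) lam = c * ?D f lam" for f c lam
    unfolding lc_dunkl_transform_def by (simp add: mult.assoc)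
  have P_add: "?P (\<lambda>x. f x + g x) = (\<lambda>x. ?P f x + ?P g x)" if "f \<in> ?S" "g \<in> ?S" for f g
    unfolding pseudo_diff_op_def D_add[OF that] using int2[OF that(1)] int2[OF that(2)]
    by (simp add: distrib_right distrib_left)
  have P_scale: "?P (\<lambda>x. c * f x) = (\<lambda>x. c * ?P f x)" for f c
    unfolding pseudo_diff_op_def D_scale
    by (simp only: mult.assoc mult.left_commute[of "\<sigma> _ _" c] integral_mult_right_zero)
  have P_diff: "?P (\<lambda>x. f x - g x) = (\<lambda>x. ?P f x - ?P g x)" if f: "f \<in> ?S" and g: "g \<in> ?S" for f g
  proof -
    \<comment> \<open>The function - g is obtained as (g - g) + (-1) g, a combination to which
      \<open>schwartz_lincomb\<close> applies.\<close>
    have "(\<lambda>x. - 1 * g x) \<in> ?S" using schwartz_lincomb[OF schwartz_diff[OF g g] g, of "-1"] by simp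
    from P_add[OF f this] show ?thesis unfolding P_scale by simp
  qed
  have "continuous_map schwartz_topology schwartz_topology ?P"
    by (rule continuous_map_schwartz[OF tame_schwartz(1)[OF P] P_diff tame_schwartz(2)[OF P]])
  thus ?thesis
    by (intro conjI ballI allI funcsetI int1 int2 tame_schwartz(1)[OF P] P_add P_scale)
qed

end
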